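(* Let $\delta>1/2$, $H=H(\delta)$, let $f_0\in L^2$ be fixed, and let $\Pi$ be a prior on $L^2$ that satisfies the weak Bernstein--von Mises phenomenon in $H$ at $f_0$, i.e. $\beta(\Pi_n\circ\tau_{\mathbb X^{(n)}}^{-1},\mathcal N)\to 0$ in $P_{f_0}^n$-probability as $n\to\infty$. Given $0<\alpha<1$ consider the credible set $$C_n=\{f:\ \|f-\mathbb X^{(n)}\|_H\le R_n/\sqrt n\},$$ where $R_n\equiv R(\mathbb X^{(n)},\alpha)$ is such that $\Pi(C_n\mid\mathbb X^{(n)})=1-\alpha$. Then, as $n\to\infty$, $$P_{f_0}^n(f_0\in C_n)\to 1-\alpha\quad\text{and}\quad R_n=O_P(1).$$ If in addition the posterior mean $\bar f_n=\int f\,d\Pi(f\mid\mathbb X^{(n)})$ satisfies $\|\bar f_n-\mathbb X^{(n)}\|_H=o_P(n^{-1/2})$, then the same conclusions hold if in the definition of $C_n$ (with $R_n$ again such that $\Pi(C_n\mid\mathbb X^{(n)})=1-\alpha$) the posterior mean $\bar f_n$ replaces $\mathbb X^{(n)}$.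
   Context: Basis. $L^2=L^2([0,1])$ with $\langle f,g\rangle=\int_0^1 f\bar g$. Let $S\in\mathbb N$. Fix an $S$-regular orthonormal basis $\{\psi_{lk}: l\in\mathcal L,k\in\mathcal Z_l\}$ of $L^2$ ($\mathcal L,\mathcal Z_l\subset\mathbb Z$) with characteristic sequence $a_l$, meaning that every $\psi_{lk}$ is $S$-times differentiable with all derivatives in $L^2$ and either (a) $|\mathcal Z_l|=1$ and $a_l=\max(2,|l|)$, or (b) $\mathcal L\subset\mathbb N=\{1,2,\dots\}$ and $a_l=|\mathcal Z_l|=2^l$. Space $H$. For $\delta>1/2$, $H(\delta)$ is the Hilbert space of linear forms $f$ on $\mathrm{span}\{\psi_{lk}\}$ (identified with their coefficient families $f(\psi_{lk})$, also written $\langle f,\psi_{lk}\rangle$) with $\|f\|_{H(\delta)}^2=\sum_{l}a_l^{-1}(\log a_l)^{-2\delta}\sum_{k}|\langle f,\psi_{lk}\rangle|^2<\infty$. It contains $L^2$. Standard white noise $\mathbb W$, with i.i.d. $N(0,1)$ coefficients $\mathbb W(\psi_{lk})$, is a tight centered Gaussian Borel random variable in $H(\delta)$ (covariance $E\,\mathbb W(g)\mathbb W(h)=\langle g,h\rangle$); its law on $H(\delta)$ is denoted $\mathcal N$. Model. For $f\in L^2$ one observes $\mathbb X^{(n)}=f+n^{-1/2}\mathbb W$ in $H(\delta)$ (equivalently $dX^{(n)}(t)=f(t)dt+n^{-1/2}dW(t)$, $t\in[0,1]$); its law is $P_f^n$. A prior $\Pi$ is a Borel probability measure on $L^2$; $\Pi_n=\Pi(\cdot\mid\mathbb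 X^{(n)})$ is the posterior, i.e. the conditional law of $f$ given $\mathbb X^{(n)}$ when $f\sim\Pi$ and $\mathbb X^{(n)}\mid f\sim P_f^n$, given by Bayes' formula with likelihood $dP_f^n/dP_0^n=\exp(n\langle f,\mathbb X^{(n)}\rangle-\tfrac n2\|f\|_2^2)$; it is viewed as a Borel measure on $H(\delta)$ through $L^2\subset H(\delta)$. The posterior is studied when $\mathbb X^{(n)}\sim P_{f_0}^n$; $o_P,O_P$ refer to $P_{f_0}^n$. Weak Bernstein--von Mises phenomenon. For $z\in H$ put $\tau_z(f)=\sqrt n(f-z)$. Let $\beta(\mu,\nu)=\sup_u|\int u\,d(\mu-\nu)|$ be the bounded Lipschitz metric on Borel probability measures on $H$, the supremum being over $u:H\to\mathbb R$ with $\sup|u|+\mathrm{Lip}(u)\le1$. The phenomenon holds if $\beta(\Pi_n\circ\tau_{\mathbb X^{(n)}}^{-1},\mathcal N)\to0$ in $P_{f_0}^n$-probability. *)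

theory Defs
  imports "HOL-Probability.Probability"
begin

text \<open>
  Scalars are real: the signal, the noise coefficients (i.i.d. standard normal) and the exponent of
  the likelihood are real, so the conjugation in the inner product is the identity.
\<close>

definition sq_integrable :: "(real \<Rightarrow> real) \<Rightarrow> bool" where
  "sq_integrable f \<longleftrightarrow>
     f \<in> borel_measurable (lebesgue_on {0..1}) \<and> integrable (lebesgue_on {0..1}) (\<lambda>x. (f x)\<^sup>2)"

definition l2_rel :: "(real \<Rightarrow> real) \<Rightarrow> (real \<Rightarrow> real) \<Rightarrow> bool" where
  "l2_rel f g \<longleftrightarrow>
     sq_integrable f \<and> sq_integrable g \<and> (AE x in lebesgue_on {0..1}. f x = g x)"

lemma sq_integrable_zero: "sq_integrable (\<lambda>_. 0)"
  by (simp add: sq_integrable_def)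

lemma sq_integrable_mult:
  assumes "sq_integrable f" "sq_integrable g"
  shows "integrable (lebesgue_on {0..1}) (\<lambda>x. f x * g x)"
proof (rule Bochner_Integration.integrable_bound)
  show "integrable (lebesgue_on {0..1}) (\<lambda>x. (f x)\<^sup>2 + (g x)\<^sup>2)"
    using assms by (auto simp: sq_integrable_def)
  show "(\<lambda>x. f x * g x) \<in> borel_measurable (lebesgue_on {0..1})"
    using assms by (auto simp: sq_integrable_def)
  have "\<bar>a * b\<bar> \<le> a\<^sup>2 + b\<^sup>2" for a b :: real
  proof -
    have "2 * (\<bar>a\<bar> * \<bar>b\<bar>) \<le> a\<^sup>2 + b\<^sup>2"
      using sum_squares_bound[of "\<bar>a\<bar>" "\<bar>b\<bar>"] by (simp add: mult.assoc)
    moreover have "0 \<le> \<bar>a\<bar> * \<bar>b\<bar>" by simp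
    ultimately show ?thesis unfolding abs_mult by linarith
  qed
  then show "AE x in lebesgue_on {0..1}. norm (f x * g x) \<le> norm ((f x)\<^sup>2 + (g x)\<^sup>2)"
    by auto
qed

lemma sq_integrable_add:
  assumes "sq_integrable f" "sq_integrable g"
  shows "sq_integrable (\<lambda>x. f x + g x)"
  using assms sq_integrable_mult[OF assms]
  by (auto simp: sq_integrable_def power2_sum mult.assoc)

lemma sq_integrable_cmult:
  assumes "sq_integrable f" shows "sq_integrable (\<lambda>x. c * f x)"
  using assms by (auto simp: sq_integrable_def power_mult_distrib)

lemma sq_integrable_minus:
  assumes "sq_integrable f" shows "sq_integrable (\<lambda>x. - f x)"
  using assms by (auto simp: sq_integrable_def)

lemma sq_integrable_diff:
  assumes "sq_integrable f" "sq_integrable g"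
  shows "sq_integrable (\<lambda>x. f x - g x)"
  using sq_integrable_add[OF assms(1) sq_integrable_minus[OF assms(2)]] by simp

quotient_type l2 = "real \<Rightarrow> real" / partial: l2_rel
proof (rule part_equivpI)
  show "\<exists>x. l2_rel x x"
    using sq_integrable_zero by (auto simp: l2_rel_def)
  show "symp l2_rel"
    by (auto simp: symp_def l2_rel_def)
  show "transp l2_rel"
    unfolding transp_def l2_rel_def by (auto elim: AE_mp)
qed

instantiation l2 :: real_inner
begin

lift_definition zero_l2 :: l2 is "\<lambda>_. 0"
  by (simp add: l2_rel_def sq_integrable_zero)

lift_definition plus_l2 :: "l2 \<Rightarrow> l2 \<Rightarrow> l2" is "\<lambda>f g x. f x + g x"
  unfolding l2_rel_def by (auto simp: sq_integrable_add)

lift_definition minus_l2 :: "l2 \<Rightarrow> l2 \<Rightarrow> l2" is "\<lambda>f g x. f x - g x"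
  unfolding l2_rel_def by (auto simp: sq_integrable_diff)

lift_definition uminus_l2 :: "l2 \<Rightarrow> l2" is "\<lambda>f x. - f x"
  unfolding l2_rel_def by (auto simp: sq_integrable_minus)

lift_definition scaleR_l2 :: "real \<Rightarrow> l2 \<Rightarrow> l2" is "\<lambda>c f x. c * f x"
  unfolding l2_rel_def by (auto simp: sq_integrable_cmult)

lift_definition inner_l2 :: "l2 \<Rightarrow> l2 \<Rightarrow> real" is
  "\<lambda>f g. integral\<^sup>L (lebesgue_on {0..1}) (\<lambda>x. f x * g x)"
  unfolding l2_rel_def sq_integrable_def by (intro integral_cong_AE) auto

definition norm_l2 :: "l2 \<Rightarrow> real" where "norm_l2 f = sqrt (inner f f)"
definition dist_l2 :: "l2 \<Rightarrow> l2 \<Rightarrow> real" where "dist_l2 f g = norm (f - g)"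
definition sgn_l2 :: "l2 \<Rightarrow> l2" where "sgn_l2 f = inverse (norm f) *\<^sub>R f"
definition uniformity_l2 :: "(l2 \<times> l2) filter" where
  "uniformity_l2 = (INF e\<in>{0 <..}. principal {(x, y). dist x y < e})"
definition open_l2 :: "l2 set \<Rightarrow> bool" where
  "open_l2 U \<longleftrightarrow> (\<forall>x\<in>U. eventually (\<lambda>(x', y). x' = x \<longrightarrow> y \<in> U) uniformity)"

instance
proof
  fix f g h :: l2 and a b :: real
  show "f + g + h = f + (g + h)"
    by transfer (auto simp: l2_rel_def sq_integrable_add add.assoc)
  show "f + g = g + f"
    by transfer (auto simp: l2_rel_def sq_integrable_add add.commute)
  show "0 + f = f"
    by transfer (auto simp: l2_rel_def)
  show "- f + f = 0"
    by transfer (auto simp: l2_rel_def sq_integrable_zero)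
  show "f - g = f + - g"
    by transfer (auto simp: l2_rel_def sq_integrable_diff)
  show "a *\<^sub>R (f + g) = a *\<^sub>R f + a *\<^sub>R g"
    by transfer (auto simp: l2_rel_def distrib_left intro!: sq_integrable_add sq_integrable_cmult)
  show "(a + b) *\<^sub>R f = a *\<^sub>R f + b *\<^sub>R f"
    by transfer (auto simp: l2_rel_def distrib_right intro!: sq_integrable_add sq_integrable_cmult)
  show "a *\<^sub>R b *\<^sub>R f = (a * b) *\<^sub>R f"
    by transfer (auto simp: l2_rel_def mult.assoc
        intro!: sq_integrable_cmult sq_integrable_cmult[of _ "_ * _", unfolded mult.assoc])
  show "1 *\<^sub>R f = f"
    by transfer (auto simp: l2_rel_def)
  show "inner f g = inner g f"
    by transfer (simp add: mult.commute)
  show "inner (f + g) h = inner f h + inner g h"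
    by transfer (auto simp: l2_rel_def distrib_right sq_integrable_mult)
  show "inner (a *\<^sub>R f) g = a * inner f g"
    by transfer (auto simp: l2_rel_def mult.assoc)
  show "0 \<le> inner f f"
    by transfer simp
  show "inner f f = 0 \<longleftrightarrow> f = 0"
  proof transfer
    fix f assume "l2_rel f f"
    then have f: "sq_integrable f" by (simp add: l2_rel_def)
    then have "integrable (lebesgue_on {0..1}) (\<lambda>x. f x * f x)"
      by (rule sq_integrable_mult) fact
    then have "(integral\<^sup>L (lebesgue_on {0..1}) (\<lambda>x. f x * f x) = 0) =
        (AE x in lebesgue_on {0..1}. f x * f x = 0)"
      by (rule integral_nonneg_eq_0_iff_AE) simp
    then show "(integral\<^sup>L (lebesgue_on {0..1}) (\<lambda>x. f x * f x) = 0) = l2_rel f (\<lambda>_. 0)"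
      using f by (simp add: l2_rel_def sq_integrable_zero)
  qed
qed (fact norm_l2_def dist_l2_def sgn_l2_def uniformity_l2_def open_l2_def)+

end

text \<open>
  \<open>wav B l k\<close> is a function on the line of which only the restriction to \<open>[0,1]\<close> matters; only
  \<open>l \<in> lev B\<close> and \<open>k \<in> loc B l\<close> are relevant, and \<open>chr B\<close> is the characteristic sequence.
\<close>

record wbasis =
  lev :: "int set"
  loc :: "int \<Rightarrow> int set"
  wav :: "int \<Rightarrow> int \<Rightarrow> real \<Rightarrow> real"
  chr :: "int \<Rightarrow> real"

definition idx :: "wbasis \<Rightarrow> (int \<times> int) set" where
  "idx B = Sigma (lev B) (loc B)"

definition bvec :: "wbasis \<Rightarrow> int \<times> int \<Rightarrow> l2" where
  "bvec B = (\<lambda>(l, k). abs_l2 (wav B l k))"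

definition regular_fun :: "nat \<Rightarrow> (real \<Rightarrow> real) \<Rightarrow> bool" where
  "regular_fun S \<psi> \<longleftrightarrow>
     (\<exists>D :: nat \<Rightarrow> real \<Rightarrow> real. D 0 = \<psi> \<and>
        (\<forall>j<S. \<forall>x\<in>{0..1}. (D j has_real_derivative D (Suc j) x) (at x within {0..1})) \<and>
        (\<forall>j\<le>S. sq_integrable (D j)))"

definition orthonormal_basis :: "wbasis \<Rightarrow> bool" where
  "orthonormal_basis B \<longleftrightarrow>
     (\<forall>i\<in>idx B. \<forall>j\<in>idx B. inner (bvec B i) (bvec B j) = (if i = j then 1 else 0)) \<and>
     closure (span (bvec B ` idx B)) = UNIV"

definition characteristic_seq :: "wbasis \<Rightarrow> bool" where
  "characteristic_seq B \<longleftrightarrow>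
     (\<forall>l\<in>lev B. card (loc B l) = 1 \<and> chr B l = max 2 \<bar>real_of_int l\<bar>) \<or>
     (lev B \<subseteq> {1..} \<and> (\<forall>l\<in>lev B. card (loc B l) = 2 ^ nat l \<and> chr B l = 2 ^ nat l))"

definition regular_basis :: "nat \<Rightarrow> wbasis \<Rightarrow> bool" where
  "regular_basis S B \<longleftrightarrow>
     (\<forall>l\<in>lev B. \<forall>k\<in>loc B l. regular_fun S (wav B l k)) \<and>
     orthonormal_basis B \<and> characteristic_seq B"

text \<open>
  A linear form on the span of the basis is represented by its coefficient family, extended by
  zero outside the index set.
\<close>

definition hweight :: "wbasis \<Rightarrow> real \<Rightarrow> int \<Rightarrow> real" where
  "hweight B \<delta> l = inverse (chr B l) * ln (chr B l) powr (- 2 * \<delta>)"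

definition hterm :: "wbasis \<Rightarrow> real \<Rightarrow> (int \<times> int \<Rightarrow> real) \<Rightarrow> int \<Rightarrow> real" where
  "hterm B \<delta> x l = hweight B \<delta> l * (\<Sum>k\<in>loc B l. (x (l, k))\<^sup>2)"

definition Hsp :: "wbasis \<Rightarrow> real \<Rightarrow> (int \<times> int \<Rightarrow> real) set" where
  "Hsp B \<delta> = {x. (\<forall>i. i \<notin> idx B \<longrightarrow> x i = 0) \<and> hterm B \<delta> x summable_on lev B}"

definition hnorm :: "wbasis \<Rightarrow> real \<Rightarrow> (int \<times> int \<Rightarrow> real) \<Rightarrow> real" where
  "hnorm B \<delta> x = sqrt (\<Sum>\<^sub>\<infinity>l\<in>lev B. hterm B \<delta> x l)"

definition hdist :: "wbasis \<Rightarrow> real \<Rightarrow> (int \<times> int \<Rightarrow> real) \<Rightarrow> (int \<times> int \<Rightarrow> real) \<Rightarrow> real" where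
  "hdist B \<delta> x y = hnorm B \<delta> (\<lambda>i. x i - y i)"

lemma characteristic_seqD:
  assumes "characteristic_seq B" "l \<in> lev B"
  shows "chr B l \<ge> 2" and "finite (loc B l)"
proof -
  have "(2::real) \<le> 2 ^ nat l" if "l \<ge> 1"
    using that power_increasing[of 1 "nat l" "2::real"] by simp
  then show "chr B l \<ge> 2"
    using assms by (auto simp: characteristic_seq_def)
  have "card (loc B l) > 0"
    using assms by (auto simp: characteristic_seq_def)
  then show "finite (loc B l)"
    using card_gt_0_iff by blast
qed

lemma hweight_pos: "characteristic_seq B \<Longrightarrow> l \<in> lev B \<Longrightarrow> hweight B \<delta> l > 0"
  using characteristic_seqD(1)[of B l] by (auto simp: hweight_def)

lemma hterm_eq:
  assumes "characteristic_seq B" "l \<in> lev B"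
  shows "hterm B \<delta> x l = (\<Sum>k\<in>loc B l. (sqrt (hweight B \<delta> l) * x (l, k))\<^sup>2)"
  using hweight_pos[OF assms, of \<delta>] by (simp add: hterm_def power_mult_distrib sum_distrib_left)

lemma hterm_nonneg:
  assumes "characteristic_seq B" "l \<in> lev B"
  shows "hterm B \<delta> x l \<ge> 0"
  by (simp add: hterm_eq[OF assms] sum_nonneg)

lemma Hsp_add:
  assumes B: "characteristic_seq B" and x: "x \<in> Hsp B \<delta>" and y: "y \<in> Hsp B \<delta>"
  shows "(\<lambda>i. x i + y i) \<in> Hsp B \<delta>"
    and "hnorm B \<delta> (\<lambda>i. x i + y i) \<le> hnorm B \<delta> x + hnorm B \<delta> y"
proof -
  define c where "c l = sqrt (hweight B \<delta> l)" for l
  note nn = hterm_nonneg[OF B]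
  have L2: "sqrt (sum (hterm B \<delta> x) F) = L2_set (\<lambda>(l, k). c l * x (l, k)) (Sigma F (loc B))"
    if "finite F" "F \<subseteq> lev B" for x F
  proof -
    have "sum (hterm B \<delta> x) F = (\<Sum>l\<in>F. \<Sum>k\<in>loc B l. (c l * x (l, k))\<^sup>2)"
      using that by (intro sum.cong) (auto simp: hterm_eq[OF B] c_def)
    also have "\<dots> = (\<Sum>(l, k)\<in>Sigma F (loc B). (c l * x (l, k))\<^sup>2)"
      using that characteristic_seqD(2)[OF B] by (intro sum.Sigma) auto
    finally show ?thesis
      by (simp add: L2_set_def case_prod_unfold)
  qed
  have le: "sqrt (sum (hterm B \<delta> x) F) \<le> hnorm B \<delta> x"
    if "finite F" "F \<subseteq> lev B" "x \<in> Hsp B \<delta>" for x F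
    using that nn unfolding hnorm_def Hsp_def
    by (intro real_sqrt_le_mono finite_sum_le_infsum) auto
  have fin: "sum (hterm B \<delta> (\<lambda>i. x i + y i)) F \<le> (hnorm B \<delta> x + hnorm B \<delta> y)\<^sup>2"
    if F: "finite F" "F \<subseteq> lev B" for F
  proof -
    have "sqrt (sum (hterm B \<delta> (\<lambda>i. x i + y i)) F) \<le>
        sqrt (sum (hterm B \<delta> x) F) + sqrt (sum (hterm B \<delta> y) F)"
      unfolding L2[OF F] using L2_set_triangle_ineq[of "\<lambda>(l, k). c l * x (l, k)" "\<lambda>(l, k). c l * y (l, k)"]
      by (simp add: case_prod_unfold distrib_left)
    also have "\<dots> \<le> hnorm B \<delta> x + hnorm B \<delta> y"
      by (intro add_mono le F x y)
    finally show ?thesis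
      by (rule sqrt_le_D)
  qed
  have sm: "hterm B \<delta> (\<lambda>i. x i + y i) summable_on lev B"
    using nn fin by (intro nonneg_bdd_above_summable_on) (auto intro!: bdd_aboveI)
  then show "(\<lambda>i. x i + y i) \<in> Hsp B \<delta>"
    using x y by (auto simp: Hsp_def)
  have "(\<Sum>\<^sub>\<infinity>l\<in>lev B. hterm B \<delta> (\<lambda>i. x i + y i) l) \<le> (hnorm B \<delta> x + hnorm B \<delta> y)\<^sup>2"
    using sm fin by (rule infsum_le_finite_sums)
  moreover have "hnorm B \<delta> x \<ge> 0" "hnorm B \<delta> y \<ge> 0"
    using nn by (auto simp: hnorm_def intro!: infsum_nonneg)
  ultimately show "hnorm B \<delta> (\<lambda>i. x i + y i) \<le> hnorm B \<delta> x + hnorm B \<delta> y"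
    unfolding hnorm_def[of B \<delta> "\<lambda>i. x i + y i"] by (intro real_le_lsqrt) auto
qed

lemma hterm_minus: "hterm B \<delta> (\<lambda>i. - x i) = hterm B \<delta> x"
  by (auto simp: hterm_def)

lemma Hsp_minus: "x \<in> Hsp B \<delta> \<Longrightarrow> (\<lambda>i. - x i) \<in> Hsp B \<delta>"
  by (simp add: Hsp_def hterm_minus)

lemma Hsp_diff:
  assumes "characteristic_seq B" "x \<in> Hsp B \<delta>" "y \<in> Hsp B \<delta>"
  shows "(\<lambda>i. x i - y i) \<in> Hsp B \<delta>"
  using Hsp_add(1)[OF assms(1,2) Hsp_minus[OF assms(3)]] by simp

lemma hnorm_eq_0_imp:
  assumes B: "characteristic_seq B" and x: "x \<in> Hsp B \<delta>" and "hnorm B \<delta> x = 0"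
  shows "x i = 0"
proof (cases "i \<in> idx B")
  case True
  then obtain l k where i: "i = (l, k)" "l \<in> lev B" "k \<in> loc B l"
    by (auto simp: idx_def)
  note nn = hterm_nonneg[OF B]
  have "hterm B \<delta> x l = 0"
    using nn i x assms(3) nonneg_infsum_le_0D[of "hterm B \<delta> x" "lev B" l]
    by (auto simp: hnorm_def Hsp_def)
  then show ?thesis
    using i characteristic_seqD(2)[OF B i(2)] hweight_pos[OF B i(2), of \<delta>]
    by (auto simp: hterm_eq[OF B i(2)] sum_nonneg_eq_0_iff)
qed (use x in \<open>cases i; simp add: Hsp_def\<close>)

lemma Metric_space_Hsp:
  assumes B: "characteristic_seq B"
  shows "Metric_space (Hsp B \<delta>) (hdist B \<delta>)"
proof
  fix x y z
  have sym: "hdist B \<delta> x y = hdist B \<delta> y x" for x y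
    using hterm_minus[of B \<delta> "\<lambda>i. x i - y i"] by (simp add: hdist_def hnorm_def)
  then show "hdist B \<delta> x y = hdist B \<delta> y x" .
  show "0 \<le> hdist B \<delta> x y"
    by (auto simp: hdist_def hnorm_def intro!: infsum_nonneg hterm_nonneg[OF B])
  assume x: "x \<in> Hsp B \<delta>" and y: "y \<in> Hsp B \<delta>"
  show "hdist B \<delta> x y = 0 \<longleftrightarrow> x = y"
    using hnorm_eq_0_imp[OF B Hsp_diff[OF B x y]]
    by (auto simp: hdist_def hnorm_def hterm_def fun_eq_iff)
  assume z: "z \<in> Hsp B \<delta>"
  show "hdist B \<delta> x z \<le> hdist B \<delta> x y + hdist B \<delta> y z"
    using Hsp_add(2)[OF B Hsp_diff[OF B x y] Hsp_diff[OF B y z]] by (simp add: hdist_def)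
qed

definition borel_H :: "wbasis \<Rightarrow> real \<Rightarrow> (int \<times> int \<Rightarrow> real) measure" where
  "borel_H B \<delta> = sigma (Hsp B \<delta>) {U. openin (Metric_space.mtopology (Hsp B \<delta>) (hdist B \<delta>)) U}"

definition l2_coeffs :: "wbasis \<Rightarrow> l2 \<Rightarrow> int \<times> int \<Rightarrow> real" where
  "l2_coeffs B f i = (if i \<in> idx B then inner f (bvec B i) else 0)"

definition white_noise ::
    "wbasis \<Rightarrow> real \<Rightarrow> 'w measure \<Rightarrow> ('w \<Rightarrow> int \<times> int \<Rightarrow> real) \<Rightarrow> bool" where
  "white_noise B \<delta> M W \<longleftrightarrow>
     prob_space M \<and> W \<in> M \<rightarrow>\<^sub>M borel_H B \<delta> \<and>
     prob_space.indep_vars M (\<lambda>_. borel) (\<lambda>i \<omega>. W \<omega> i) (idx B) \<and>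
     (\<forall>i\<in>idx B. distributed M lborel (\<lambda>\<omega>. W \<omega> i) std_normal_density)"

definition noise_law ::
    "wbasis \<Rightarrow> real \<Rightarrow> 'w measure \<Rightarrow> ('w \<Rightarrow> int \<times> int \<Rightarrow> real) \<Rightarrow> (int \<times> int \<Rightarrow> real) measure" where
  "noise_law B \<delta> M W = distr M (borel_H B \<delta>) W"

definition data_law ::
    "wbasis \<Rightarrow> real \<Rightarrow> 'w measure \<Rightarrow> ('w \<Rightarrow> int \<times> int \<Rightarrow> real) \<Rightarrow> l2 \<Rightarrow> nat
      \<Rightarrow> (int \<times> int \<Rightarrow> real) measure" where
  "data_law B \<delta> M W f n =
     distr M (borel_H B \<delta>) (\<lambda>\<omega> i. l2_coeffs B f i + W \<omega> i / sqrt (real n))"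

text \<open>
  For \<open>f\<close> in \<open>L\<^sup>2\<close> and a data point \<open>x\<close>, the pairing \<open>\<langle>f, x\<rangle>\<close> is the almost sure limit of
  the sums over an exhausting sequence of finite windows (the series need not converge
  unconditionally, so an unordered infinite sum would be wrong).
\<close>

definition pairing_part :: "wbasis \<Rightarrow> l2 \<Rightarrow> (int \<times> int \<Rightarrow> real) \<Rightarrow> nat \<Rightarrow> real" where
  "pairing_part B f x N =
     (\<Sum>i \<in> idx B \<inter> ({- int N..int N} \<times> {- int N..int N}). l2_coeffs B f i * x i)"

definition pairing :: "wbasis \<Rightarrow> l2 \<Rightarrow> (int \<times> int \<Rightarrow> real) \<Rightarrow> real" where
  "pairing B f x = (if convergent (pairing_part B f x) then lim (pairing_part B f x) else 0)"

definition likelihood :: "wbasis \<Rightarrow> nat \<Rightarrow> (int \<times> int \<Rightarrow> real) \<Rightarrow> l2 \<Rightarrow> real" where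
  "likelihood B n x f = exp (real n * pairing B f x - real n / 2 * (norm f)\<^sup>2)"

definition posterior :: "wbasis \<Rightarrow> l2 measure \<Rightarrow> nat \<Rightarrow> (int \<times> int \<Rightarrow> real) \<Rightarrow> l2 measure" where
  "posterior B prior n x =
     density prior (\<lambda>f. ennreal (likelihood B n x f) / (\<integral>\<^sup>+ g. ennreal (likelihood B n x g) \<partial>prior))"

definition posterior_H ::
    "wbasis \<Rightarrow> real \<Rightarrow> l2 measure \<Rightarrow> nat \<Rightarrow> (int \<times> int \<Rightarrow> real) \<Rightarrow> (int \<times> int \<Rightarrow> real) measure" where
  "posterior_H B \<delta> prior n x = distr (posterior B prior n x) (borel_H B \<delta>) (l2_coeffs B)"

text \<open>
  The mean is the \<open>H(\<delta>)\<close>-valued weak integral; it has these coefficients whenever the integral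
  exists as a Bochner integral in \<open>L\<^sup>2\<close> or in \<open>H(\<delta>)\<close>.
\<close>

definition posterior_mean ::
    "wbasis \<Rightarrow> l2 measure \<Rightarrow> nat \<Rightarrow> (int \<times> int \<Rightarrow> real) \<Rightarrow> int \<times> int \<Rightarrow> real" where
  "posterior_mean B prior n x i = (\<integral>f. l2_coeffs B f i \<partial>posterior B prior n x)"

definition has_posterior_mean ::
    "wbasis \<Rightarrow> real \<Rightarrow> l2 measure \<Rightarrow> nat \<Rightarrow> (int \<times> int \<Rightarrow> real) \<Rightarrow> bool" where
  "has_posterior_mean B \<delta> prior n x \<longleftrightarrow>
     (\<forall>i\<in>idx B. integrable (posterior B prior n x) (\<lambda>f. l2_coeffs B f i)) \<and>
     posterior_mean B prior n x \<in> Hsp B \<delta>"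

text \<open>
  Convergence in probability is stated with outer probabilities, so that it does not presuppose
  measurability of the statistic; on measurable events these are the probabilities.
\<close>

definition outer_prob :: "'a measure \<Rightarrow> 'a set \<Rightarrow> real" where
  "outer_prob P A = Inf {measure P E | E. E \<in> sets P \<and> A \<subseteq> E}"

definition tendsto_zero_in_prob :: "(nat \<Rightarrow> 'a measure) \<Rightarrow> (nat \<Rightarrow> 'a \<Rightarrow> real) \<Rightarrow> bool" where
  "tendsto_zero_in_prob P Y \<longleftrightarrow>
     (\<forall>\<epsilon>>0. (\<lambda>n. outer_prob (P n) {x \<in> space (P n). \<bar>Y n x\<bar> > \<epsilon>}) \<longlonglongrightarrow> 0)"

definition bounded_in_prob :: "(nat \<Rightarrow> 'a measure) \<Rightarrow> (nat \<Rightarrow> 'a \<Rightarrow> real) \<Rightarrow> bool" where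
  "bounded_in_prob P Y \<longleftrightarrow>
     (\<forall>\<epsilon>>0. \<exists>K. \<forall>\<^sub>F n in sequentially.
        outer_prob (P n) {x \<in> space (P n). \<bar>Y n x\<bar> > K} < \<epsilon>)"

text \<open>\<open>b\<close> and \<open>c\<close> bound the supremum norm and the Lipschitz constant of \<open>u\<close>.\<close>

definition BL1 :: "wbasis \<Rightarrow> real \<Rightarrow> ((int \<times> int \<Rightarrow> real) \<Rightarrow> real) set" where
  "BL1 B \<delta> = {u. \<exists>b\<ge>0. \<exists>c\<ge>0. b + c \<le> 1 \<and>
     (\<forall>x\<in>Hsp B \<delta>. \<bar>u x\<bar> \<le> b) \<and>
     (\<forall>x\<in>Hsp B \<delta>. \<forall>y\<in>Hsp B \<delta>. \<bar>u x - u y\<bar> \<le> c * hdist B \<delta> x y)}"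

definition bl_metric ::
    "wbasis \<Rightarrow> real \<Rightarrow> (int \<times> int \<Rightarrow> real) measure \<Rightarrow> (int \<times> int \<Rightarrow> real) measure \<Rightarrow> real" where
  "bl_metric B \<delta> \<mu> \<nu> = (SUP u\<in>BL1 B \<delta>. \<bar>(\<integral>x. u x \<partial>\<mu>) - (\<integral>x. u x \<partial>\<nu>)\<bar>)"

definition rescale ::
    "nat \<Rightarrow> (int \<times> int \<Rightarrow> real) \<Rightarrow> (int \<times> int \<Rightarrow> real) \<Rightarrow> int \<times> int \<Rightarrow> real" where
  "rescale n z f = (\<lambda>i. sqrt (real n) * (f i - z i))"

definition weak_BvM ::
    "wbasis \<Rightarrow> real \<Rightarrow> 'w measure \<Rightarrow> ('w \<Rightarrow> int \<times> int \<Rightarrow> real) \<Rightarrow> l2 measure \<Rightarrow> l2 \<Rightarrow> bool" where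
  "weak_BvM B \<delta> M W prior f0 \<longleftrightarrow>
     tendsto_zero_in_prob (data_law B \<delta> M W f0)
       (\<lambda>n x. bl_metric B \<delta>
          (distr (posterior_H B \<delta> prior n x) (borel_H B \<delta>) (rescale n x)) (noise_law B \<delta> M W))"

definition credible_set ::
    "wbasis \<Rightarrow> real \<Rightarrow> nat \<Rightarrow> (int \<times> int \<Rightarrow> real) \<Rightarrow> real \<Rightarrow> (int \<times> int \<Rightarrow> real) set" where
  "credible_set B \<delta> n z r = {f \<in> Hsp B \<delta>. hdist B \<delta> f z \<le> r / sqrt (real n)}"

definition credible_radius ::
    "wbasis \<Rightarrow> real \<Rightarrow> 'w measure \<Rightarrow> ('w \<Rightarrow> int \<times> int \<Rightarrow> real) \<Rightarrow> l2 measure \<Rightarrow> l2 \<Rightarrow> real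
      \<Rightarrow> (nat \<Rightarrow> (int \<times> int \<Rightarrow> real) \<Rightarrow> int \<times> int \<Rightarrow> real)
      \<Rightarrow> (nat \<Rightarrow> (int \<times> int \<Rightarrow> real) \<Rightarrow> real) \<Rightarrow> bool" where
  "credible_radius B \<delta> M W prior f0 \<alpha> z R \<longleftrightarrow>
     (\<forall>n\<ge>1. R n \<in> borel_measurable (borel_H B \<delta>) \<and>
        (AE x in data_law B \<delta> M W f0 n.
           measure (posterior_H B \<delta> prior n x) (credible_set B \<delta> n (z n x) (R n x)) = 1 - \<alpha>))"

end

theory Submission
  imports Defs
begin

text \<open>
  Let \<open>F\<close> be the distribution function of the noise norm; it is continuous. Since
  \<open>\<surd>n \<parallel>f\<^sub>0 - X\<parallel>\<close> has distribution function \<open>F\<close>, the coverage of the ball of radius \<open>R\<^sub>n/\<surd>n\<close> is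
  determined once \<open>F(R\<^sub>n)\<close> is known to tend to \<open>1 - \<alpha>\<close> in probability. A Lipschitz cut-off of the
  norm turns closeness in the bounded Lipschitz metric into the two-sided bound
  \<open>F(R\<^sub>n - 2\<epsilon>) - \<eta> \<le> 1 - \<alpha> \<le> F(R\<^sub>n + 2\<epsilon>) + \<eta>\<close>. Replacing \<open>X\<close> by a centre at distance
  \<open>o(n\<^sup>-\<^sup>1\<^sup>/\<^sup>2)\<close> costs only one of these \<open>\<epsilon>\<close>. Monotonicity of \<open>F\<close>, not strict monotonicity, suffices:
  levels slightly below and above \<open>1 - \<alpha>\<close> are attained by continuity, and they trap \<open>R\<^sub>n\<close>.
\<close>

section \<open>The space \<open>H(\<delta>)\<close>\<close>

text \<open>For real functions unordered summability is absolute summability, hence integrability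
  for counting measure; otherwise both sides take the default value 0. This opens series to the
  measurability theorem for integrals with a parameter.\<close>

lemma infsum_eq_lebesgue_integral:
  fixes f :: "'a \<Rightarrow> real"
  shows "infsum f A = (\<integral>x. f x \<partial>count_space A)"
proof (cases "f summable_on A")
  case True
  then have "Infinite_Set_Sum.abs_summable_on f A"
    using abs_summable_equivalent summable_on_iff_abs_summable_on_real by blast
  from infsetsum_infsum[OF this] show ?thesis
    by (simp add: infsetsum_def)
next
  case False
  then have "\<not> integrable (count_space A) f"
    unfolding Infinite_Set_Sum.abs_summable_on_def[symmetric]
    using abs_summable_equivalent summable_on_iff_abs_summable_on_real by blast
  with False show ?thesis
    by (simp add: infsum_not_exists not_integrable_integral_eq)
qed

text \<open>Counting measure on a countable set is sigma-finite, and with a countable factor joint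
  measurability follows from that of each \<open>f a\<close>; the rest is measurability of a partial
  integral.\<close>

lemma borel_measurable_infsum:
  fixes f :: "'a \<Rightarrow> 'b \<Rightarrow> real"
  assumes A: "countable A" and f: "\<And>a. a \<in> A \<Longrightarrow> f a \<in> borel_measurable M"
  shows "(\<lambda>x. \<Sum>\<^sub>\<infinity>a\<in>A. f a x) \<in> borel_measurable M"
proof -
  interpret sigma_finite_measure "count_space A"
    by (rule sigma_finite_measure_count_space_countable[OF A])
  have "(\<lambda>(x, a). f a x) \<in> borel_measurable (M \<Otimes>\<^sub>M count_space A)"
    using measurable_pair_swap[OF measurable_pair_measure_countable1[OF A,
        of "\<lambda>(a, x). f a x" M borel]] f by (simp add: case_prod_unfold)
  then show ?thesis
    unfolding infsum_eq_lebesgue_integral by (rule borel_measurable_lebesgue_integral)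
qed

section \<open>Norm and metric of the weighted sequence space\<close>

locale sequence_space =
  fixes B :: wbasis and \<delta> :: real
  assumes chr_seq: "characteristic_seq B"
begin

abbreviation "H \<equiv> Hsp B \<delta>"
abbreviation "nrm \<equiv> hnorm B \<delta>"
abbreviation "dst \<equiv> hdist B \<delta>"
abbreviation "bor \<equiv> borel_H B \<delta>"

sublocale Metric_space H dst
  by (rule Metric_space_Hsp[OF chr_seq])

lemma hterm_zero [simp]: "hterm B \<delta> (\<lambda>_. 0) = (\<lambda>_. 0)"
  by (simp add: fun_eq_iff hterm_def)

lemma H_zero [simp]: "(\<lambda>_. 0) \<in> H"
  by (simp add: Hsp_def)

lemma nrm_zero [simp]: "nrm (\<lambda>_. 0) = 0"
  by (simp add: hnorm_def)

lemma nrm_nonneg [simp]: "0 \<le> nrm x"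
  by (auto simp: hnorm_def intro!: infsum_nonneg hterm_nonneg[OF chr_seq])

lemma hterm_scale: "hterm B \<delta> (\<lambda>i. c * x i) = (\<lambda>l. c\<^sup>2 * hterm B \<delta> x l)"
  by (simp add: fun_eq_iff hterm_def power_mult_distrib sum_distrib_left mult_ac)

lemma H_scale: "x \<in> H \<Longrightarrow> (\<lambda>i. c * x i) \<in> H"
  by (auto simp: Hsp_def hterm_scale intro: summable_on_cmult_right)

lemma nrm_scale: "nrm (\<lambda>i. c * x i) = \<bar>c\<bar> * nrm x"
  by (simp add: hnorm_def hterm_scale infsum_cmult_right' real_sqrt_mult)

lemma dst_zero: "dst x (\<lambda>_. 0) = nrm x"
  by (simp add: hdist_def)

lemma nrm_lipschitz: "x \<in> H \<Longrightarrow> y \<in> H \<Longrightarrow> \<bar>nrm x - nrm y\<bar> \<le> dst x y"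
  using triangle[of x y "\<lambda>_. 0"] triangle[of y x "\<lambda>_. 0"] commute[of x y] by (simp add: dst_zero)

lemma dst_lipschitz: "x \<in> H \<Longrightarrow> y \<in> H \<Longrightarrow> z \<in> H \<Longrightarrow> \<bar>dst x z - dst y z\<bar> \<le> dst x y"
  using triangle[of x y z] triangle[of y x z] commute[of x y] by simp

text \<open>One square is at most its level sum, and one level at most the whole series of
  nonnegative terms. This makes every coordinate Lipschitz, hence Borel.\<close>

lemma coordinate_le:
  assumes x: "x \<in> H" and l: "l \<in> lev B" and k: "k \<in> loc B l"
  shows "sqrt (hweight B \<delta> l) * \<bar>x (l, k)\<bar> \<le> nrm x"
proof -
  have "(sqrt (hweight B \<delta> l) * x (l, k))\<^sup>2 \<le> hterm B \<delta> x l"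
    using k characteristic_seqD(2)[OF chr_seq l] unfolding hterm_eq[OF chr_seq l]
    by (intro member_le_sum[of k _ "\<lambda>k. (sqrt (hweight B \<delta> l) * x (l, k))\<^sup>2"]) auto
  also have "\<dots> = infsum (hterm B \<delta> x) {l}"
    by simp
  also have "\<dots> \<le> infsum (hterm B \<delta> x) (lev B)"
    using x l by (intro infsum_mono_neutral) (auto simp: Hsp_def hterm_nonneg[OF chr_seq])
  finally have "\<bar>sqrt (hweight B \<delta> l) * x (l, k)\<bar> \<le> nrm x"
    by (simp add: hnorm_def real_le_rsqrt)
  then show ?thesis
    using hweight_pos[OF chr_seq l, of \<delta>] by (simp add: abs_mult)
qed

section \<open>Borel measurability from Lipschitz bounds\<close>

lemma open_Pow: "{U. openin mtopology U} \<subseteq> Pow H"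
  by (auto simp: openin_mtopology)

lemma space_bor [simp]: "space bor = H"
  unfolding borel_H_def by (rule space_measure_of[OF open_Pow])

lemma open_in_bor: "openin mtopology U \<Longrightarrow> U \<in> sets bor"
  unfolding borel_H_def
  by (rule in_measure_of[OF open_Pow]) simp

lemma lipschitz_measurable_real:
  fixes f :: "_ \<Rightarrow> real"
  assumes f: "\<And>x y. x \<in> H \<Longrightarrow> y \<in> H \<Longrightarrow> \<bar>f x - f y\<bar> \<le> L * dst x y"
  shows "f \<in> borel_measurable bor"
proof (rule borel_measurableI)
  fix U :: "real set" assume U: "open U"
  have "openin mtopology (f -` U \<inter> H)"
    unfolding openin_mtopology
  proof safe
    fix x assume x: "f x \<in> U" "x \<in> H"
    then obtain e where e: "e > 0" "\<And>t. \<bar>t - f x\<bar> < e \<Longrightarrow> t \<in> U"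
      using U unfolding open_dist dist_real_def by blast
    \<comment> \<open>The denominator \<open>\<bar>L\<bar> + 1\<close> is positive for every L, so
      zero or negative constants need no separate case.\<close>
    have "\<bar>f y - f x\<bar> < e" if y: "y \<in> mball x (e / (\<bar>L\<bar> + 1))" for y
    proof -
      have "\<bar>f y - f x\<bar> \<le> L * dst x y"
        using f[of x y] y x by (auto simp: abs_minus_commute)
      also have "\<dots> \<le> (\<bar>L\<bar> + 1) * dst x y"
        by (intro mult_right_mono) auto
      also have "\<dots> < e"
        using y e(1) by (simp add: pos_less_divide_eq mult.commute)
      finally show ?thesis .
    qed
    with e show "\<exists>r>0. mball x r \<subseteq> f -` U \<inter> H"
      by (intro exI[of _ "e / (\<bar>L\<bar> + 1)"]) auto
  qed
  then show "f -` U \<inter> space bor \<in> sets bor"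
    by (simp add: open_in_bor)
qed

lemma measurable_to_bor:
  assumes g: "g \<in> space N \<rightarrow> H"
    and U: "\<And>U. openin mtopology U \<Longrightarrow> g -` U \<inter> space N \<in> sets N"
  shows "g \<in> N \<rightarrow>\<^sub>M bor"
  unfolding borel_H_def using g U by (intro measurable_measure_of open_Pow) auto

lemma lipschitz_measurable_bor:
  assumes g: "g \<in> H \<rightarrow> H"
    and f: "\<And>x y. x \<in> H \<Longrightarrow> y \<in> H \<Longrightarrow> dst (g x) (g y) \<le> L * dst x y"
  shows "g \<in> bor \<rightarrow>\<^sub>M bor"
proof (rule measurable_to_bor)
  fix U assume U: "openin mtopology U"
  have "openin mtopology (g -` U \<inter> H)"
    unfolding openin_mtopology
  proof safe
    fix x assume x: "g x \<in> U" "x \<in> H"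
    then obtain e where e: "e > 0" "mball (g x) e \<subseteq> U"
      using U unfolding openin_mtopology by blast
    have "g y \<in> mball (g x) e" if y: "y \<in> mball x (e / (\<bar>L\<bar> + 1))" for y
    proof -
      have "dst (g x) (g y) \<le> L * dst x y"
        using f[of x y] y x by auto
      also have "\<dots> \<le> (\<bar>L\<bar> + 1) * dst x y"
        by (intro mult_right_mono) auto
      also have "\<dots> < e"
        using y e(1) by (simp add: pos_less_divide_eq mult.commute)
      finally show ?thesis using g x y by auto
    qed
    with e have "mball x (e / (\<bar>L\<bar> + 1)) \<subseteq> g -` U \<inter> H"
      using mball_subset_mspace by blast
    with e show "\<exists>r>0. mball x r \<subseteq> g -` U \<inter> H"
      by (intro exI[of _ "e / (\<bar>L\<bar> + 1)"]) auto
  qed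
  then show "g -` U \<inter> space bor \<in> sets bor"
    by (simp add: open_in_bor)
qed (use g in simp)

lemma nrm_measurable [measurable]: "nrm \<in> borel_measurable bor"
  by (rule lipschitz_measurable_real[of _ 1]) (simp add: nrm_lipschitz)

lemma dst_measurable: "z \<in> H \<Longrightarrow> (\<lambda>x. dst x z) \<in> borel_measurable bor"
  by (rule lipschitz_measurable_real[of _ 1]) (simp add: dst_lipschitz)

lemma coordinate_measurable [measurable]: "(\<lambda>x. x i) \<in> borel_measurable bor"
proof (cases "i \<in> idx B")
  case True
  then obtain l k where i: "i = (l, k)" "l \<in> lev B" "k \<in> loc B l"
    by (auto simp: idx_def)
  note w = hweight_pos[OF chr_seq i(2), of \<delta>]
  show ?thesis
  proof (rule lipschitz_measurable_real[of _ "1 / sqrt (hweight B \<delta> l)"])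
    fix x y assume "x \<in> H" "y \<in> H"
    from coordinate_le[OF Hsp_diff[OF chr_seq this] i(2,3)]
    show "\<bar>x i - y i\<bar> \<le> 1 / sqrt (hweight B \<delta> l) * dst x y"
      using w i(1) by (simp add: hdist_def field_simps)
  qed
next
  case False
  \<comment> \<open>Off the index set every element of H vanishes, so the coordinate is constant and
    has Lipschitz constant 0.\<close>
  then show ?thesis
    by (intro lipschitz_measurable_real[of _ 0]) (simp add: Hsp_def del: split_paired_All)
qed

lemma rescale_in_H: "z \<in> H \<Longrightarrow> x \<in> H \<Longrightarrow> rescale n z x \<in> H"
  unfolding rescale_def by (intro H_scale Hsp_diff chr_seq)

lemma nrm_rescale: "nrm (rescale n z x) = sqrt (real n) * dst x z"
  unfolding rescale_def nrm_scale by (simp add: hdist_def)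

lemma rescale_measurable [measurable]:
  assumes "z \<in> H" shows "rescale n z \<in> bor \<rightarrow>\<^sub>M bor"
proof (rule lipschitz_measurable_bor)
  fix x y assume "x \<in> H" "y \<in> H"
  have "dst (rescale n z x) (rescale n z y) = nrm (\<lambda>i. sqrt (real n) * (x i - y i))"
    by (simp add: hdist_def rescale_def algebra_simps)
  then show "dst (rescale n z x) (rescale n z y) \<le> sqrt (real n) * dst x y"
    unfolding nrm_scale by (simp add: hdist_def)
qed (use assms rescale_in_H in auto)

lemma affine_measurable:
  assumes c: "c \<in> H" shows "(\<lambda>x i. c i + x i / r) \<in> bor \<rightarrow>\<^sub>M bor"
proof (rule lipschitz_measurable_bor)
  show "(\<lambda>x i. c i + x i / r) \<in> H \<rightarrow> H"
    using Hsp_add(1)[OF chr_seq c H_scale[of _ "1 / r"]] by auto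
  fix x y assume "x \<in> H" "y \<in> H"
  have "dst (\<lambda>i. c i + x i / r) (\<lambda>i. c i + y i / r) = nrm (\<lambda>i. 1 / r * (x i - y i))"
    by (simp add: hdist_def diff_divide_distrib)
  then show "dst (\<lambda>i. c i + x i / r) (\<lambda>i. c i + y i / r) \<le> \<bar>1 / r\<bar> * dst x y"
    unfolding nrm_scale by (simp add: hdist_def)
qed

text \<open>The norm is assembled from coordinates by finite sums and a countable series. This
  covers maps known only coordinatewise and possibly leaving H, such as zero extensions of points of
  a product space and posterior means.\<close>

lemma nrm_coordinatewise_measurable:
  assumes "\<And>i. i \<in> idx B \<Longrightarrow> (\<lambda>\<omega>. g \<omega> i) \<in> borel_measurable N"
  shows "(\<lambda>\<omega>. nrm (g \<omega>)) \<in> borel_measurable N"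
proof -
  have "(\<lambda>\<omega>. hterm B \<delta> (g \<omega>) l) \<in> borel_measurable N" if "l \<in> lev B" for l
    unfolding hterm_def
    by (intro borel_measurable_times borel_measurable_const borel_measurable_sum
        borel_measurable_power assms) (use that in \<open>simp add: idx_def\<close>)
  then have "(\<lambda>\<omega>. infsum (hterm B \<delta> (g \<omega>)) (lev B)) \<in> borel_measurable N"
    by (intro borel_measurable_infsum[where f = "\<lambda>l \<omega>. hterm B \<delta> (g \<omega>) l"]) auto
  then show ?thesis
    unfolding hnorm_def by (rule measurable_compose[OF _ borel_measurable_sqrt])
qed

end

section \<open>The embedding of \<open>L\<^sup>2\<close> into \<open>H(\<delta>)\<close>\<close>

text \<open>Expand the nonnegative squared length of the residual \<open>f - p\<close>, where p is
  the orthogonal projection of f onto the span of the vectors \<open>e i\<close>.\<close>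

lemma bessel_inequality:
  fixes e :: "'i \<Rightarrow> 'a::real_inner"
  assumes F: "finite F" and e: "\<And>i j. i \<in> F \<Longrightarrow> j \<in> F \<Longrightarrow> inner (e i) (e j) = (if i = j then 1 else 0)"
  shows "(\<Sum>i\<in>F. (inner f (e i))\<^sup>2) \<le> (norm f)\<^sup>2"
proof -
  define p where "p = (\<Sum>i\<in>F. inner f (e i) *\<^sub>R e i)"
  have fp: "inner f p = (\<Sum>i\<in>F. (inner f (e i))\<^sup>2)"
    by (simp add: p_def inner_sum_right power2_eq_square)
  have "inner (e i) p = inner f (e i)" if "i \<in> F" for i
    using that F e by (simp add: p_def inner_sum_right if_distrib[of "\<lambda>x. _ * x"] cong: if_cong)
  then have pp: "inner p p = (\<Sum>i\<in>F. (inner f (e i))\<^sup>2)"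
    \<comment> \<open>Only the left argument is expanded; the right one stays p so that the
      preceding identity evaluates each term.\<close>
    unfolding p_def[THEN arg_cong[of _ _ "\<lambda>q. inner q p"]]
    by (simp add: inner_sum_left power2_eq_square)
  have "0 \<le> inner (f - p) (f - p)"
    by simp
  also have "\<dots> = (norm f)\<^sup>2 - (\<Sum>i\<in>F. (inner f (e i))\<^sup>2)"
    using fp pp by (simp add: inner_diff_left inner_diff_right inner_commute power2_norm_eq_inner)
  finally show ?thesis by simp
qed

locale basis_space = sequence_space +
  assumes orthonormal: "orthonormal_basis B" and delta_pos: "\<delta> > 0"
begin

text \<open>With \<open>chr B l\<close> at least 2 the reciprocal is at most 1, and the negative
  power of the logarithm is largest at 2. A bound uniform in l is what embeds the square integrable
  functions into H.\<close>

lemma hweight_le: "l \<in> lev B \<Longrightarrow> hweight B \<delta> l \<le> ln 2 powr (- 2 * \<delta>)"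
proof -
  assume "l \<in> lev B"
  then have c: "chr B l \<ge> 2"
    by (rule characteristic_seqD(1)[OF chr_seq])
  have "ln (chr B l) powr (- 2 * \<delta>) \<le> ln 2 powr (- 2 * \<delta>)"
    using c delta_pos by (intro powr_mono2') auto
  moreover have "inverse (chr B l) \<le> 1"
    using c by (simp add: inverse_le_1_iff)
  ultimately show ?thesis
    using c unfolding hweight_def by (intro mult_le_one[THEN order_trans] mult_left_le_one_le[THEN order_trans]) auto
qed

text \<open>Uniformly bounded weights reduce sums over finitely many levels to Bessel's inequality.
  The resulting bound does not depend on F, so it yields summability and the norm estimate at
  once.\<close>

lemma l2_coeffs_in_H: "l2_coeffs B f \<in> H"
  and nrm_l2_coeffs_le: "nrm (l2_coeffs B f) \<le> sqrt (ln 2 powr (- 2 * \<delta>)) * norm f"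
proof -
  define K where "K = ln 2 powr (- 2 * \<delta>)"
  have K: "K \<ge> 0" by (simp add: K_def)
  note nn = hterm_nonneg[OF chr_seq]
  have fin: "sum (hterm B \<delta> (l2_coeffs B f)) F \<le> K * (norm f)\<^sup>2" if F: "finite F" "F \<subseteq> lev B" for F
  proof -
    have "sum (hterm B \<delta> (l2_coeffs B f)) F \<le> (\<Sum>l\<in>F. K * (\<Sum>k\<in>loc B l. (l2_coeffs B f (l, k))\<^sup>2))"
      unfolding hterm_def K_def using F
      by (intro sum_mono mult_right_mono hweight_le) (auto intro: sum_nonneg)
    also have "\<dots> = K * (\<Sum>i\<in>Sigma F (loc B). (l2_coeffs B f i)\<^sup>2)"
      using F characteristic_seqD(2)[OF chr_seq]
      by (subst sum.Sigma[symmetric, of F "loc B" "\<lambda>l k. (l2_coeffs B f (l, k))\<^sup>2", simplified case_prod_unfold prod.collapse])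
         (auto simp: sum_distrib_left)
    also have "(\<Sum>i\<in>Sigma F (loc B). (l2_coeffs B f i)\<^sup>2) = (\<Sum>i\<in>Sigma F (loc B). (inner f (bvec B i))\<^sup>2)"
      using F by (intro sum.cong) (auto simp: l2_coeffs_def idx_def)
    also have "K * \<dots> \<le> K * (norm f)\<^sup>2"
    proof (intro mult_left_mono bessel_inequality finite_SigmaI)
      fix i j assume "i \<in> Sigma F (loc B)" "j \<in> Sigma F (loc B)"
      then have "i \<in> idx B" "j \<in> idx B"
        using F by (auto simp: idx_def)
      then show "inner (bvec B i) (bvec B j) = (if i = j then 1 else 0)"
        using orthonormal by (simp add: orthonormal_basis_def)
    qed (use F K characteristic_seqD(2)[OF chr_seq] in auto)
    finally show ?thesis .
  qed
  then have sm: "hterm B \<delta> (l2_coeffs B f) summable_on lev B"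
    using nn by (intro nonneg_bdd_above_summable_on) (auto intro!: bdd_aboveI)
  then show "l2_coeffs B f \<in> H"
    by (auto simp: Hsp_def l2_coeffs_def)
  have "(\<Sum>\<^sub>\<infinity>l\<in>lev B. hterm B \<delta> (l2_coeffs B f) l) \<le> K * (norm f)\<^sup>2"
    using sm fin by (rule infsum_le_finite_sums)
  then have "nrm (l2_coeffs B f) \<le> sqrt (K * (norm f)\<^sup>2)"
    unfolding hnorm_def by (rule real_sqrt_le_mono)
  then show "nrm (l2_coeffs B f) \<le> sqrt (ln 2 powr (- 2 * \<delta>)) * norm f"
    by (simp add: real_sqrt_mult K_def)
qed

text \<open>The embedding is linear and bounded, so it is Lipschitz with constant c and pulls open
  sets back to open sets.\<close>

lemma l2_coeffs_measurable [measurable]: "l2_coeffs B \<in> borel \<rightarrow>\<^sub>M bor"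
proof (rule measurable_to_bor)
  fix U assume U: "openin mtopology U"
  define c where "c = sqrt (ln 2 powr (- 2 * \<delta>))"
  have c: "c > 0" by (simp add: c_def)
  have lip: "dst (l2_coeffs B f) (l2_coeffs B g) \<le> c * dist f g" for f g
  proof -
    have "(\<lambda>i. l2_coeffs B f i - l2_coeffs B g i) = l2_coeffs B (f - g)"
      by (auto simp: l2_coeffs_def inner_diff_left)
    then show ?thesis
      using nrm_l2_coeffs_le[of "f - g"] by (simp add: hdist_def dist_norm c_def)
  qed
  have "open (l2_coeffs B -` U)"
    unfolding open_dist
  proof safe
    fix f assume "l2_coeffs B f \<in> U"
    then obtain e where e: "e > 0" "mball (l2_coeffs B f) e \<subseteq> U"
      using U unfolding openin_mtopology by blast
    have "l2_coeffs B g \<in> U" if "dist g f < e / c" for g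
    proof -
      have "dst (l2_coeffs B f) (l2_coeffs B g) < e"
        using lip[of f g] that c by (simp add: field_simps dist_commute)
      then show ?thesis
        using e l2_coeffs_in_H by auto
    qed
    then show "\<exists>r>0. \<forall>g. dist g f < r \<longrightarrow> g \<in> l2_coeffs B -` U"
      using e c by (intro exI[of _ "e / c"]) auto
  qed
  then show "l2_coeffs B -` U \<inter> space borel \<in> sets borel"
    by simp
qed (auto intro: l2_coeffs_in_H)

lemma l2_coeff_measurable [measurable]: "(\<lambda>f. l2_coeffs B f i) \<in> borel_measurable borel"
  using measurable_compose[OF l2_coeffs_measurable coordinate_measurable] .

text \<open>An empty family spans only 0, whereas the constant function 1 has norm 1. The noise
  therefore has at least one coordinate to split off.\<close>

lemma idx_nonempty: "idx B \<noteq> {}"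
proof
  assume "idx B = {}"
  then have "(UNIV :: l2 set) = {0}"
    using orthonormal by (simp add: orthonormal_basis_def)
  moreover have "abs_l2 (\<lambda>_. 1) \<noteq> 0"
  proof -
    have 1: "l2_rel (\<lambda>_. 1) (\<lambda>_. 1)"
      by (simp add: l2_rel_def sq_integrable_def)
    have "inner (abs_l2 (\<lambda>_. 1)) (abs_l2 (\<lambda>_. 1)) = 1"
      using 1 by (simp add: inner_l2.abs_eq measure_restrict_space)
    then show ?thesis by auto
  qed
  ultimately show False by auto
qed

end

section \<open>The noise norm has no atoms\<close>

text \<open>Independence makes the joint law a product, so Fubini reduces the claim to sections at a
  fixed value of V. Such a section has at most two points, which are null for a law with a Lebesgue
  density.\<close>

lemma (in prob_space) indep_square_plus_no_atom:
  fixes X V :: "'a \<Rightarrow> real"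
  assumes ind: "indep_var borel X borel V" and X: "distributed M lborel X f" and c: "c \<noteq> 0"
  shows "prob {\<omega> \<in> space M. c * (X \<omega>)\<^sup>2 + V \<omega> = s} = 0"
proof -
  define A where "A = {p :: real \<times> real. c * (fst p)\<^sup>2 + snd p = s}"
  have rv: "random_variable borel X" "random_variable borel V"
    and eq: "distr M borel X \<Otimes>\<^sub>M distr M borel V = distr M (borel \<Otimes>\<^sub>M borel) (\<lambda>\<omega>. (X \<omega>, V \<omega>))"
    using ind unfolding indep_var_distribution_eq by auto
  note rv[measurable]
  interpret X: prob_space "distr M borel X" by (rule prob_space_distr) fact
  interpret V: prob_space "distr M borel V" by (rule prob_space_distr) fact
  interpret XV: pair_prob_space "distr M borel X" "distr M borel V" ..
  have "{p \<in> space (borel \<Otimes>\<^sub>M borel :: (real \<times> real) measure). c * (fst p)\<^sup>2 + snd p = s} \<in> sets (borel \<Otimes>\<^sub>M borel)"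
    by measurable
  then have A: "A \<in> sets (borel \<Otimes>\<^sub>M borel)"
    by (simp add: A_def space_pair_measure)
  have "emeasure (distr M borel X) ((\<lambda>x. (x, y)) -` A) = 0" for y
  proof -
    \<comment> \<open>If the quotient is negative the section is empty, so the two candidate roots
      serve for every sign.\<close>
    have "(\<lambda>x. (x, y)) -` A \<subseteq> {sqrt ((s - y) / c), - sqrt ((s - y) / c)}"
    proof
      fix x assume "x \<in> (\<lambda>x. (x, y)) -` A"
      then have "sqrt ((s - y) / c) = \<bar>x\<bar>"
        using c by (auto simp: A_def field_simps intro!: real_sqrt_unique)
      then show "x \<in> {sqrt ((s - y) / c), - sqrt ((s - y) / c)}"
        by (auto simp: abs_if split: if_splits)
    qed
    then have "(\<lambda>x. (x, y)) -` A \<in> null_sets lborel"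
      by (intro finite_imp_null_set_lborel) (rule finite_subset, auto)
    moreover have "distr M borel X = density lborel f"
      using distributed_distr_eq_density[OF X] by (metis distr_cong sets_lborel)
    moreover have "absolutely_continuous lborel (density lborel f)"
      using X by (intro absolutely_continuousI_density) (simp add: distributed_def)
    ultimately show ?thesis
      by (auto simp: absolutely_continuous_def)
  qed
  then have "emeasure (distr M borel X \<Otimes>\<^sub>M distr M borel V) A = 0"
    using A by (subst XV.emeasure_pair_measure_alt2) auto
  then have "emeasure M ((\<lambda>\<omega>. (X \<omega>, V \<omega>)) -` A \<inter> space M) = 0"
    unfolding eq using A by (subst (asm) emeasure_distr) auto
  moreover have "(\<lambda>\<omega>. (X \<omega>, V \<omega>)) -` A \<inter> space M = {\<omega> \<in> space M. c * (X \<omega>)\<^sup>2 + V \<omega> = s}"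
    by (auto simp: A_def)
  ultimately show ?thesis
    by (simp add: measure_def)
qed

context sequence_space
begin

text \<open>Only level l changes, and there by the single term carrying (l, k). For the squared norm
  this is an additive splitting, which separates one Gaussian coordinate from all others.\<close>

lemma nrm_split_coordinate:
  assumes x: "x \<in> H" and l: "l \<in> lev B" and k: "k \<in> loc B l"
  shows "(nrm x)\<^sup>2 = hweight B \<delta> l * (x (l, k))\<^sup>2 + (nrm (x((l, k) := 0)))\<^sup>2"
proof -
  let ?y = "x((l, k) := 0)"
  define d where "d m = (if m = l then hweight B \<delta> l * (x (l, k))\<^sup>2 else 0)" for m
  have split: "hterm B \<delta> x m = hterm B \<delta> ?y m + d m" if m: "m \<in> lev B" for m
  proof (cases "m = l")
    case True
    have fin: "finite (loc B l)"
      by (rule characteristic_seqD(2)[OF chr_seq l])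
    have "(\<Sum>j\<in>loc B l. (x (l, j))\<^sup>2) = (x (l, k))\<^sup>2 + (\<Sum>j\<in>loc B l - {k}. (x (l, j))\<^sup>2)"
      using fin k by (rule sum.remove)
    moreover have "(\<Sum>j\<in>loc B l. (?y (l, j))\<^sup>2) = (?y (l, k))\<^sup>2 + (\<Sum>j\<in>loc B l - {k}. (?y (l, j))\<^sup>2)"
      using fin k by (rule sum.remove)
    moreover have "(\<Sum>j\<in>loc B l - {k}. (?y (l, j))\<^sup>2) = (\<Sum>j\<in>loc B l - {k}. (x (l, j))\<^sup>2)"
      by (intro sum.cong) auto
    ultimately show ?thesis
      using True by (simp add: hterm_def d_def algebra_simps)
  next
    case False
    then have "(?y (m, j))\<^sup>2 = (x (m, j))\<^sup>2" for j
      by simp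
    then have "hterm B \<delta> ?y m = hterm B \<delta> x m"
      unfolding hterm_def by (simp only:)
    with False show ?thesis
      unfolding d_def by (simp only: if_False add_0_right)
  qed
  have d: "(d has_sum (hweight B \<delta> l * (x (l, k))\<^sup>2)) (lev B)"
    by (rule has_sum_finite_neutralI[of "{l}"]) (use l in \<open>auto simp: d_def\<close>)
  have d0: "0 \<le> d m" if "m \<in> lev B" for m
    using hweight_pos[OF chr_seq l, of \<delta>] by (simp add: d_def)
  \<comment> \<open>The series of the changed family is dominated by that of x; its convergence is
    needed before the sum can be split.\<close>
  have "hterm B \<delta> ?y summable_on lev B"
  proof (rule summable_on_comparison_test)
    show "hterm B \<delta> x summable_on lev B"
      using x by (simp add: Hsp_def)
    show "hterm B \<delta> ?y m \<le> hterm B \<delta> x m" if "m \<in> lev B" for m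
      using split[OF that] d0[OF that] by simp
  qed (rule hterm_nonneg[OF chr_seq])
  then have "((\<lambda>m. hterm B \<delta> ?y m + d m) has_sum
      (infsum (hterm B \<delta> ?y) (lev B) + hweight B \<delta> l * (x (l, k))\<^sup>2)) (lev B)"
    using d by (intro has_sum_add) auto
  then have "(\<Sum>\<^sub>\<infinity>m\<in>lev B. hterm B \<delta> ?y m + d m) =
      infsum (hterm B \<delta> ?y) (lev B) + hweight B \<delta> l * (x (l, k))\<^sup>2"
    by (rule infsumI)
  moreover have "(\<Sum>\<^sub>\<infinity>m\<in>lev B. hterm B \<delta> ?y m + d m) = infsum (hterm B \<delta> x) (lev B)"
    by (intro infsum_cong) (simp add: split)
  moreover have "(nrm v)\<^sup>2 = infsum (hterm B \<delta> v) (lev B)" for v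
    unfolding hnorm_def by (intro real_sqrt_pow2 infsum_nonneg hterm_nonneg[OF chr_seq])
  ultimately show ?thesis
    by simp
qed

end

locale noise_model = basis_space +
  fixes M :: "'w measure" and W :: "'w \<Rightarrow> int \<times> int \<Rightarrow> real"
  assumes noise: "white_noise B \<delta> M W"
begin

sublocale prob_space M
  using noise by (simp add: white_noise_def)

lemma W_measurable [measurable]: "W \<in> M \<rightarrow>\<^sub>M bor"
  using noise by (simp add: white_noise_def)

lemma W_in_H: "\<omega> \<in> space M \<Longrightarrow> W \<omega> \<in> H"
  using measurable_space[OF W_measurable] by simp

lemma nrm_W_measurable [measurable]: "(\<lambda>\<omega>. nrm (W \<omega>)) \<in> borel_measurable M"
  by (rule measurable_compose[OF W_measurable nrm_measurable])

text \<open>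
  Splitting off one coordinate writes the squared norm as a positive multiple of a squared
  Gaussian plus an independent remainder; given the remainder, an atom would force the Gaussian
  into a set of at most two points.
\<close>

lemma nrm_W_no_atom: "prob {\<omega> \<in> space M. nrm (W \<omega>) = t} = 0"
proof -
  obtain l k where l: "l \<in> lev B" and k: "k \<in> loc B l"
    using idx_nonempty by (auto simp: idx_def)
  let ?i = "(l, k)" and ?J = "idx B - {(l, k)}"
  have i: "?i \<in> idx B"
    using l k by (simp add: idx_def)
  \<comment> \<open>\<open>g\<close> erases coordinate (l, k) and everything outside the index set,
    so its norm depends on the coordinates in \<open>?J\<close> alone, as the grouping of
    independent variables requires.\<close>
  define g where "g y j = (if j \<in> ?J then y j else 0)" for y :: "int \<times> int \<Rightarrow> real" and j
  have "indep_vars (\<lambda>_. borel) (\<lambda>i \<omega>. W \<omega> i) (idx B)"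
    using noise by (simp add: white_noise_def)
  then have "indep_var (PiM {?i} (\<lambda>_. borel)) (\<lambda>\<omega>. \<lambda>j\<in>{?i}. W \<omega> j) (PiM ?J (\<lambda>_. borel)) (\<lambda>\<omega>. \<lambda>j\<in>?J. W \<omega> j)"
    using i by (intro indep_var_restrict) auto
  moreover have "(\<lambda>y. (nrm (g y))\<^sup>2) \<in> borel_measurable (PiM ?J (\<lambda>_. borel))"
  proof (intro borel_measurable_power nrm_coordinatewise_measurable)
    fix j
    show "(\<lambda>y. g y j) \<in> borel_measurable (PiM ?J (\<lambda>_. borel))"
      by (cases "j \<in> ?J") (simp_all add: g_def measurable_component_singleton del: Diff_iff)
  qed
  ultimately have "indep_var borel ((\<lambda>y. y ?i) \<circ> (\<lambda>\<omega>. \<lambda>j\<in>{?i}. W \<omega> j))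
      borel ((\<lambda>y. (nrm (g y))\<^sup>2) \<circ> (\<lambda>\<omega>. \<lambda>j\<in>?J. W \<omega> j))"
    by (intro indep_var_compose) auto
  moreover have "g (\<lambda>j\<in>?J. W \<omega> j) = g (W \<omega>)" for \<omega>
    by (auto simp: g_def)
  ultimately have "indep_var borel (\<lambda>\<omega>. W \<omega> ?i) borel (\<lambda>\<omega>. (nrm (g (W \<omega>)))\<^sup>2)"
    by (simp add: comp_def)
  moreover have "distributed M lborel (\<lambda>\<omega>. W \<omega> ?i) std_normal_density"
    using noise i by (auto simp: white_noise_def)
  moreover have "hweight B \<delta> l \<noteq> 0"
    using hweight_pos[OF chr_seq l, of \<delta>] by simp
  ultimately have null: "prob {\<omega> \<in> space M. hweight B \<delta> l * (W \<omega> ?i)\<^sup>2 + (nrm (g (W \<omega>)))\<^sup>2 = t\<^sup>2} = 0"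
    and meas: "(\<lambda>\<omega>. W \<omega> ?i) \<in> borel_measurable M" "(\<lambda>\<omega>. (nrm (g (W \<omega>)))\<^sup>2) \<in> borel_measurable M"
    by (auto intro: indep_square_plus_no_atom dest: indep_var_rv1 indep_var_rv2)
  have "(nrm (W \<omega>))\<^sup>2 = hweight B \<delta> l * (W \<omega> ?i)\<^sup>2 + (nrm (g (W \<omega>)))\<^sup>2" if "\<omega> \<in> space M" for \<omega>
  proof -
    have "(W \<omega>)(?i := 0) = g (W \<omega>)"
      using W_in_H[OF that] by (auto simp: g_def Hsp_def fun_eq_iff simp del: split_paired_All)
    then show ?thesis
      using nrm_split_coordinate[OF W_in_H[OF that] l k] by simp
  qed
  \<comment> \<open>Squaring gives an inclusion, which suffices and also covers negative t, where
    the left side is empty.\<close>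
  then have "{\<omega> \<in> space M. nrm (W \<omega>) = t} \<subseteq>
      {\<omega> \<in> space M. hweight B \<delta> l * (W \<omega> ?i)\<^sup>2 + (nrm (g (W \<omega>)))\<^sup>2 = t\<^sup>2}" (is "_ \<subseteq> ?A")
    by auto
  moreover have "?A \<in> events"
    using meas by measurable
  ultimately have "prob {\<omega> \<in> space M. nrm (W \<omega>) = t} \<le> prob ?A"
    by (intro finite_measure_mono)
  with null show ?thesis
    using measure_nonneg[of M "{\<omega> \<in> space M. nrm (W \<omega>) = t}"] by linarith
qed

section \<open>Distribution function of the noise norm\<close>

definition nrm_cdf :: "real \<Rightarrow> real" where
  "nrm_cdf t = prob {\<omega> \<in> space M. nrm (W \<omega>) \<le> t}"

lemma nrm_cdf_mono: "s \<le> t \<Longrightarrow> nrm_cdf s \<le> nrm_cdf t"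
  unfolding nrm_cdf_def by (intro finite_measure_mono) auto

text \<open>The function is the \<open>cdf\<close> of the law of the norm on the line; its
  continuity at t is the absence of an atom there.\<close>

lemma nrm_cdf_isCont: "isCont nrm_cdf t"
  and nrm_cdf_at_top: "(nrm_cdf \<longlongrightarrow> 1) at_top"
proof -
  let ?D = "distr M borel (\<lambda>\<omega>. nrm (W \<omega>))"
  interpret D: real_distribution ?D
    by (intro real_distribution.intro real_distribution_axioms.intro
        prob_space_distr nrm_W_measurable sets_distr)
  have "cdf ?D = nrm_cdf"
    by (auto simp: fun_eq_iff cdf_def nrm_cdf_def measure_distr vimage_def Int_def conj_commute)
  moreover have "measure ?D {t} = 0"
    using nrm_W_no_atom[of t] by (simp add: measure_distr vimage_def Int_def conj_commute)
  ultimately show "isCont nrm_cdf t" "(nrm_cdf \<longlongrightarrow> 1) at_top"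
    using D.isCont_cdf D.cdf_lim_at_top_prob by auto
qed

lemma nrm_cdf_neg: "t < 0 \<Longrightarrow> nrm_cdf t = 0"
proof -
  assume "t < 0"
  then have "\<not> nrm (W \<omega>) \<le> t" for \<omega>
    using nrm_nonneg[of "W \<omega>"] by linarith
  then show ?thesis
    by (simp add: nrm_cdf_def)
qed

text \<open>Intermediate values between -1, where the function vanishes because norms are
  nonnegative, and a point b where it exceeds p, which exists by the limit 1 at infinity.\<close>

lemma nrm_cdf_quantile: "0 < p \<Longrightarrow> p < 1 \<Longrightarrow> \<exists>t. nrm_cdf t = p"
proof -
  assume p: "0 < p" "p < 1"
  have "\<forall>\<^sub>F b in at_top. p < nrm_cdf b \<and> 0 \<le> b"
    using order_tendstoD(1)[OF nrm_cdf_at_top p(2)] eventually_ge_at_top[of 0]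
    by eventually_elim simp
  then obtain b where b: "b \<ge> 0" "p < nrm_cdf b"
    by (auto dest!: eventually_happens)
  have "\<exists>t. -1 \<le> t \<and> t \<le> b \<and> nrm_cdf t = p"
    using p b nrm_cdf_isCont nrm_cdf_neg[of "-1"] by (intro IVT) auto
  then show ?thesis by blast
qed

end

section \<open>Outer probabilities\<close>

lemma outer_prob_le:
  assumes "E \<in> sets P" "A \<subseteq> E"
  shows "outer_prob P A \<le> measure P E"
  unfolding outer_prob_def using assms by (intro cInf_lower bdd_belowI[of _ 0]) auto

text \<open>The condition \<open>A \<subseteq> space P\<close> makes the whole space a candidate
  cover, so the infimum runs over a nonempty set. Statements in outer probability thereby yield
  measurable exceptional sets.\<close>

lemma outer_prob_less_cover:
  assumes "outer_prob P A < \<eta>" "A \<subseteq> space P"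
  shows "\<exists>E\<in>sets P. A \<subseteq> E \<and> measure P E < \<eta>"
proof -
  have "{measure P E | E. E \<in> sets P \<and> A \<subseteq> E} \<noteq> {}"
    using assms(2) by blast
  from cInf_lessD[OF this assms(1)[unfolded outer_prob_def]] show ?thesis
    by blast
qed

lemma outer_prob_nonneg:
  assumes "A \<subseteq> space P"
  shows "0 \<le> outer_prob P A"
  unfolding outer_prob_def using assms by (intro cInf_greatest) auto

section \<open>Bounded Lipschitz comparison of ball masses\<close>

context sequence_space
begin

lemma nrm_le_sets: "sets \<mu> = sets bor \<Longrightarrow> {x \<in> H. nrm x \<le> t} \<in> sets \<mu>"
  using measurable_sets[OF nrm_measurable, of "{..t}"]
  by (simp add: vimage_def Int_def conj_commute)

text \<open>Serves to bound the family under the supremum in \<open>bl_metric\<close>, so that the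
  supremum dominates each member. Mass at most one, rather than exactly one, is assumed because the
  posterior has mass zero where the evidence is infinite.\<close>

lemma BL1_integral_le:
  assumes sets: "sets \<mu> = sets bor" and fin: "emeasure \<mu> H \<le> 1" and u: "u \<in> BL1 B \<delta>"
  shows "\<bar>\<integral>x. u x \<partial>\<mu>\<bar> \<le> 1"
proof -
  have space: "space \<mu> = H"
    using sets_eq_imp_space_eq[OF sets] by simp
  interpret finite_measure \<mu>
    using fin by (intro finite_measureI) (auto simp: space top_unique)
  have b: "\<bar>u x\<bar> \<le> 1" if "x \<in> H" for x
  proof -
    obtain b c where "b + c \<le> 1" "0 \<le> c" "\<forall>x\<in>H. \<bar>u x\<bar> \<le> b"
      using u unfolding BL1_def by blast
    then show ?thesis
      using that by (meson add_increasing2 order_trans order_refl)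
  qed
  have "\<bar>\<integral>x. u x \<partial>\<mu>\<bar> \<le> (\<integral>x. \<bar>u x\<bar> \<partial>\<mu>)"
    by (rule integral_abs_bound)
  also have "\<dots> \<le> (\<integral>x. 1 \<partial>\<mu>)"
    using b by (intro integral_mono') (auto simp: space)
  also have "\<dots> \<le> 1"
    using fin by (simp add: space measure_def enn2real_leI)
  finally show ?thesis .
qed

text \<open>A cut-off \<phi> that is 1 on the smaller ball, 0 outside the larger one and linear in
  the norm between them is squeezed between the two indicators, and the bounded Lipschitz distance
  controls its integrals.\<close>

lemma ball_mass_le:
  assumes \<mu>: "sets \<mu> = sets bor" "emeasure \<mu> H \<le> 1"
    and \<nu>: "sets \<nu> = sets bor" "emeasure \<nu> H \<le> 1" and e: "0 < e"
  shows "measure \<mu> {x \<in> H. nrm x \<le> t}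
    \<le> measure \<nu> {x \<in> H. nrm x \<le> t + e} + (1 + 1 / e) * bl_metric B \<delta> \<mu> \<nu>"
proof -
  define \<phi> where "\<phi> x = max 0 (min 1 ((t + e - nrm x) / e))" for x
  \<comment> \<open>\<phi> has supremum at most 1 and Lipschitz constant at most 1 / e; multiplied
    by k these become k and 1 / (1 + e), which add up to 1. Dividing by k gives the factor 1 + 1 /
    e.\<close>
  define k where "k = e / (1 + e)"
  define u where "u x = k * \<phi> x" for x
  have sp: "space \<mu> = H" "space \<nu> = H"
    using sets_eq_imp_space_eq[OF \<mu>(1)] sets_eq_imp_space_eq[OF \<nu>(1)] by auto
  interpret \<mu>: finite_measure \<mu>
    using \<mu>(2) by (intro finite_measureI) (auto simp: sp top_unique)
  interpret \<nu>: finite_measure \<nu>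
    using \<nu>(2) by (intro finite_measureI) (auto simp: sp top_unique)
  have k: "0 < k" "k + 1 / (1 + e) = 1"
    using e by (simp_all add: k_def field_simps)
  have \<phi>01: "0 \<le> \<phi> x" "\<phi> x \<le> 1" for x
    by (auto simp: \<phi>_def)
  have clamp: "\<bar>max 0 (min 1 r) - max 0 (min 1 s)\<bar> \<le> \<bar>r - s\<bar>" for r s :: real
    by linarith
  have u: "u \<in> BL1 B \<delta>"
    unfolding BL1_def
  proof (intro CollectI exI conjI ballI)
    show "\<bar>u x\<bar> \<le> k" for x
      using \<phi>01[of x] k(1) by (simp add: u_def abs_mult mult_left_le)
    show "\<bar>u x - u y\<bar> \<le> 1 / (1 + e) * dst x y" if "x \<in> H" "y \<in> H" for x y
    proof -
      have "\<bar>\<phi> x - \<phi> y\<bar> \<le> \<bar>(t + e - nrm x) / e - (t + e - nrm y) / e\<bar>"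
        unfolding \<phi>_def by (rule clamp)
      also have "\<dots> = \<bar>nrm x - nrm y\<bar> / e"
        using e by (simp add: diff_divide_distrib[symmetric] abs_minus_commute)
      also have "\<dots> \<le> dst x y / e"
        using e nrm_lipschitz[OF that] by (simp add: divide_right_mono)
      finally have "k * \<bar>\<phi> x - \<phi> y\<bar> \<le> k * (dst x y / e)"
        using k(1) by (intro mult_left_mono) auto
      moreover have "\<bar>u x - u y\<bar> = k * \<bar>\<phi> x - \<phi> y\<bar>"
        using k(1) by (simp add: u_def right_diff_distrib[symmetric] abs_mult)
      moreover have "k * (dst x y / e) = 1 / (1 + e) * dst x y"
        using e by (simp add: k_def)
      ultimately show ?thesis by simp
    qed
  qed (use k e in auto)
  have \<phi>m: "\<phi> \<in> borel_measurable bor"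
    unfolding \<phi>_def by measurable
  have int: "integrable \<mu> \<phi>" "integrable \<nu> \<phi>"
    using \<phi>01 \<phi>m
    by (auto intro!: \<mu>.integrable_const_bound[of _ 1] \<nu>.integrable_const_bound[of _ 1]
        simp: measurable_cong_sets[OF \<mu>(1) refl] measurable_cong_sets[OF \<nu>(1) refl])
  have "bdd_above ((\<lambda>u. \<bar>(\<integral>x. u x \<partial>\<mu>) - (\<integral>x. u x \<partial>\<nu>)\<bar>) ` BL1 B \<delta>)"
  proof (rule bdd_aboveI2)
    fix v assume v: "v \<in> BL1 B \<delta>"
    show "\<bar>(\<integral>x. v x \<partial>\<mu>) - (\<integral>x. v x \<partial>\<nu>)\<bar> \<le> 2"
      using BL1_integral_le[OF \<mu> v] BL1_integral_le[OF \<nu> v] by linarith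
  qed
  then have "\<bar>(\<integral>x. u x \<partial>\<mu>) - (\<integral>x. u x \<partial>\<nu>)\<bar> \<le> bl_metric B \<delta> \<mu> \<nu>"
    unfolding bl_metric_def by (intro cSUP_upper u)
  then have "k * ((\<integral>x. \<phi> x \<partial>\<mu>) - (\<integral>x. \<phi> x \<partial>\<nu>)) \<le> bl_metric B \<delta> \<mu> \<nu>"
    unfolding u_def by (simp add: right_diff_distrib)
  then have "(\<integral>x. \<phi> x \<partial>\<mu>) - (\<integral>x. \<phi> x \<partial>\<nu>) \<le> (1 + 1 / e) * bl_metric B \<delta> \<mu> \<nu>"
    using e by (simp add: k_def field_simps)
  moreover have "measure \<mu> {x \<in> H. nrm x \<le> t} \<le> (\<integral>x. \<phi> x \<partial>\<mu>)"
  proof -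
    have le: "indicator {x \<in> H. nrm x \<le> t} x \<le> \<phi> x" for x
      using e \<phi>01(1)[of x] by (simp add: indicator_def \<phi>_def)
    have "integrable \<mu> (indicator {x \<in> H. nrm x \<le> t} :: _ \<Rightarrow> real)"
      by (intro integrable_real_indicator nrm_le_sets \<mu>(1)) (simp add: \<mu>.emeasure_eq_measure)
    from integral_mono[OF this int(1) le] show ?thesis
      using nrm_le_sets[OF \<mu>(1)] by simp
  qed
  moreover have "(\<integral>x. \<phi> x \<partial>\<nu>) \<le> measure \<nu> {x \<in> H. nrm x \<le> t + e}"
  proof -
    have le: "\<phi> x \<le> indicator {x \<in> H. nrm x \<le> t + e} x" if "x \<in> space \<nu>" for x
      using that e \<phi>01(2)[of x] by (simp add: indicator_def \<phi>_def sp divide_nonpos_pos)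
    have "integrable \<nu> (indicator {x \<in> H. nrm x \<le> t + e} :: _ \<Rightarrow> real)"
      by (intro integrable_real_indicator nrm_le_sets \<nu>(1)) (simp add: \<nu>.emeasure_eq_measure)
    from integral_mono[OF int(2) this le] show ?thesis
      using nrm_le_sets[OF \<nu>(1)] by simp
  qed
  ultimately show ?thesis by linarith
qed

lemma bl_metric_commute: "bl_metric B \<delta> \<mu> \<nu> = bl_metric B \<delta> \<nu> \<mu>"
  by (simp add: bl_metric_def abs_minus_commute)

end

section \<open>The posterior\<close>

locale prior_model = noise_model +
  fixes prior :: "l2 measure"
  assumes prior: "prob_space prior" and sets_prior: "sets prior = sets borel"
begin

lemma prior_measurable_eq: "N \<rightarrow>\<^sub>M prior = N \<rightarrow>\<^sub>M borel" "prior \<rightarrow>\<^sub>M N = borel \<rightarrow>\<^sub>M N"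
  by (simp_all add: measurable_cong_sets[OF refl sets_prior] measurable_cong_sets[OF sets_prior refl])

lemma likelihood_measurable:
  "(\<lambda>(x, f). likelihood B n x f) \<in> borel_measurable (bor \<Otimes>\<^sub>M prior)"
proof -
  have c: "(\<lambda>p. l2_coeffs B (snd p) i) \<in> borel_measurable (bor \<Otimes>\<^sub>M prior)" for i
    by (rule measurable_compose[OF measurable_snd]) (simp add: prior_measurable_eq l2_coeff_measurable)
  have x: "(\<lambda>p. fst p i) \<in> borel_measurable (bor \<Otimes>\<^sub>M prior)" for i
    by (rule measurable_compose[OF measurable_fst coordinate_measurable])
  have part[measurable]: "(\<lambda>p. pairing_part B (snd p) (fst p) N) \<in> borel_measurable (bor \<Otimes>\<^sub>M prior)" for N
    unfolding pairing_part_def by (intro borel_measurable_sum borel_measurable_times c x)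
  \<comment> \<open>By completeness convergence is the Cauchy property, a countable combination of
    measurable events; this makes the case distinction in \<open>pairing\<close> measurable.\<close>
  have "Measurable.pred (bor \<Otimes>\<^sub>M prior) (\<lambda>p. Cauchy (\<lambda>N. pairing_part B (snd p) (fst p) N))"
    unfolding pred_def by (rule sets_Collect_Cauchy[OF part])
  moreover have "(\<lambda>p. lim (\<lambda>N. pairing_part B (snd p) (fst p) N)) \<in> borel_measurable (bor \<Otimes>\<^sub>M prior)"
    by (rule borel_measurable_lim_metric[OF part])
  ultimately have pair[measurable]: "(\<lambda>p. pairing B (snd p) (fst p)) \<in> borel_measurable (bor \<Otimes>\<^sub>M prior)"
    unfolding pairing_def Cauchy_convergent_iff[symmetric] by (intro measurable_If) simp_all
  have [measurable]: "(\<lambda>p. norm (snd p)) \<in> borel_measurable (bor \<Otimes>\<^sub>M prior)"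
    by (rule measurable_compose[OF measurable_snd]) (simp add: prior_measurable_eq borel_measurable_norm)
  show ?thesis
    unfolding likelihood_def case_prod_unfold by measurable
qed

lemma likelihood_measurable_prior:
  "x \<in> H \<Longrightarrow> (\<lambda>f. likelihood B n x f) \<in> borel_measurable prior"
  using measurable_Pair2[OF likelihood_measurable] by simp

definition evidence :: "nat \<Rightarrow> (int \<times> int \<Rightarrow> real) \<Rightarrow> ennreal" where
  "evidence n x = (\<integral>\<^sup>+ f. ennreal (likelihood B n x f) \<partial>prior)"

lemma evidence_measurable: "evidence n \<in> borel_measurable bor"
proof -
  interpret prior: prob_space prior by (rule prior)
  have "(\<lambda>(x, f). ennreal (likelihood B n x f)) \<in> borel_measurable (bor \<Otimes>\<^sub>M prior)"
    using measurable_compose[OF likelihood_measurable measurable_ennreal] by (simp add: case_prod_unfold)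
  then show ?thesis
    unfolding evidence_def by (rule prior.borel_measurable_nn_integral)
qed

text \<open>The likelihood is an exponential, so it vanishes nowhere; a zero integral would make the
  whole space null for the prior.\<close>

lemma evidence_pos: "x \<in> H \<Longrightarrow> evidence n x \<noteq> 0"
proof
  interpret prior: prob_space prior by (rule prior)
  assume x: "x \<in> H" and "evidence n x = 0"
  then have "AE f in prior. ennreal (likelihood B n x f) = 0"
    using measurable_compose[OF likelihood_measurable_prior[OF x] measurable_ennreal]
    by (simp add: evidence_def nn_integral_0_iff_AE)
  then have "AE f in prior. False"
    by (rule AE_mp) (simp add: likelihood_def)
  then show False
    by (simp add: prior.AE_False)
qed

lemma posterior_eq:
  "posterior B prior n x = density prior (\<lambda>f. ennreal (likelihood B n x f) / evidence n x)"
  by (simp add: posterior_def evidence_def)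

lemma posterior_mass:
  assumes x: "x \<in> H" shows "emeasure (posterior B prior n x) UNIV \<le> 1"
proof -
  have [measurable]: "(\<lambda>f. ennreal (likelihood B n x f)) \<in> borel_measurable prior"
    by (rule measurable_compose[OF likelihood_measurable_prior[OF x] measurable_ennreal])
  have sp: "space prior = UNIV"
    using sets_eq_imp_space_eq[OF sets_prior] by simp
  have "emeasure (posterior B prior n x) UNIV
      = (\<integral>\<^sup>+ f. ennreal (likelihood B n x f) / evidence n x \<partial>prior)"
    unfolding posterior_eq
    by (subst emeasure_density) (auto simp: sets_prior)
  also have "\<dots> = evidence n x / evidence n x"
    by (subst nn_integral_divide) (auto simp: evidence_def)
  \<comment> \<open>Infinite evidence makes the quotient 0 in \<open>ennreal\<close>; hence a bound
    by 1 rather than an equality.\<close>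
  also have "\<dots> \<le> 1"
    using evidence_pos[OF x, of n]
    by (cases "evidence n x = \<infinity>") (auto simp: less_top)
  finally show ?thesis .
qed

text \<open>Written as a prior integral with a real-valued density, the mean is an integral
  depending on the parameter x, with jointly measurable integrand.\<close>

lemma posterior_mean_measurable:
  "(\<lambda>x. posterior_mean B prior n x i) \<in> borel_measurable bor"
proof -
  interpret prior: prob_space prior by (rule prior)
  have c: "(\<lambda>f. l2_coeffs B f i) \<in> borel_measurable prior"
    by (simp add: prior_measurable_eq l2_coeff_measurable)
  have eq: "posterior_mean B prior n x i =
      (\<integral>f. likelihood B n x f / enn2real (evidence n x) * l2_coeffs B f i \<partial>prior)"
    if x: "x \<in> space bor" for x
  proof -
    have xH: "x \<in> H" using x by simp
    \<comment> \<open>For infinite evidence both sides are 0: the left divides by infinity, and on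
      the right \<open>enn2real\<close> returns 0 and division by 0 gives 0.\<close>
    have "ennreal (likelihood B n x f) / evidence n x
        = ennreal (likelihood B n x f / enn2real (evidence n x))" for f
    proof (cases "evidence n x")
      case (real r)
      then have "0 < r"
        using evidence_pos[OF xH, of n] by (simp add: less_le)
      with real show ?thesis
        by (simp add: divide_ennreal likelihood_def)
    qed simp
    then have "posterior B prior n x
        = density prior (\<lambda>f. ennreal (likelihood B n x f / enn2real (evidence n x)))"
      by (simp add: posterior_eq)
    then show ?thesis
      unfolding posterior_mean_def
      using likelihood_measurable_prior[OF xH] c
      by (simp add: integral_density likelihood_def)
  qed
  have "(\<lambda>x. \<integral>f. likelihood B n x f / enn2real (evidence n x) * l2_coeffs B f i \<partial>prior)
      \<in> borel_measurable bor"
  proof (rule prior.borel_measurable_lebesgue_integral)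
    have [measurable]: "(\<lambda>p. likelihood B n (fst p) (snd p)) \<in> borel_measurable (bor \<Otimes>\<^sub>M prior)"
      using likelihood_measurable by (simp add: case_prod_unfold)
    have [measurable]: "(\<lambda>p. l2_coeffs B (snd p) i) \<in> borel_measurable (bor \<Otimes>\<^sub>M prior)"
      by (rule measurable_compose[OF measurable_snd c])
    have [measurable]: "(\<lambda>p. evidence n (fst p)) \<in> borel_measurable (bor \<Otimes>\<^sub>M prior)"
      by (rule measurable_compose[OF measurable_fst evidence_measurable])
    show "(\<lambda>(x, f). likelihood B n x f / enn2real (evidence n x) * l2_coeffs B f i)
        \<in> borel_measurable (bor \<Otimes>\<^sub>M prior)"
      unfolding case_prod_unfold by measurable
  qed
  then show ?thesis
    by (subst measurable_cong[OF eq])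
qed

end

section \<open>Coverage of credible balls\<close>

context prior_model
begin

section \<open>Laws of the rescaled posterior, the noise and the data\<close>

abbreviation (input) "rescaled_posterior n x \<equiv> distr (posterior_H B \<delta> prior n x) bor (rescale n x)"

lemma l2_coeffs_posterior_measurable: "l2_coeffs B \<in> posterior B prior n x \<rightarrow>\<^sub>M bor"
proof -
  have "sets (posterior B prior n x) = sets borel"
    by (simp add: posterior_eq sets_prior)
  then show ?thesis
    using l2_coeffs_measurable by (simp cong: measurable_cong_sets)
qed

lemma sets_posterior_H: "sets (posterior_H B \<delta> prior n x) = sets bor"
  by (simp add: posterior_H_def)

lemma posterior_H_mass: "x \<in> H \<Longrightarrow> emeasure (posterior_H B \<delta> prior n x) H \<le> 1"
proof -
  assume x: "x \<in> H"
  have "emeasure (posterior_H B \<delta> prior n x) H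
      = emeasure (posterior B prior n x) (l2_coeffs B -` H \<inter> space (posterior B prior n x))"
    unfolding posterior_H_def using sets.top[of bor]
    by (intro emeasure_distr l2_coeffs_posterior_measurable) simp
  also have "l2_coeffs B -` H \<inter> space (posterior B prior n x) = UNIV"
    using l2_coeffs_in_H sets_eq_imp_space_eq[OF sets_prior] by (auto simp: posterior_eq)
  finally show ?thesis
    using posterior_mass[OF x] by simp
qed

lemma rescale_posterior_measurable: "x \<in> H \<Longrightarrow> rescale n x \<in> posterior_H B \<delta> prior n x \<rightarrow>\<^sub>M bor"
  using rescale_measurable by (simp cong: measurable_cong_sets[OF sets_posterior_H refl])

lemma rescaled_posterior_mass: "x \<in> H \<Longrightarrow> emeasure (rescaled_posterior n x) H \<le> 1"
proof -
  assume x: "x \<in> H"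
  have sp: "space (posterior_H B \<delta> prior n x) = H"
    using sets_eq_imp_space_eq[OF sets_posterior_H] by simp
  have "emeasure (rescaled_posterior n x) H
      = emeasure (posterior_H B \<delta> prior n x) (rescale n x -` H \<inter> H)"
    using emeasure_distr[OF rescale_posterior_measurable[OF x], of H] sets.top[of bor] by (simp add: sp)
  also have "rescale n x -` H \<inter> H = H"
    using rescale_in_H[OF x] by auto
  finally show ?thesis
    using posterior_H_mass[OF x] by simp
qed

lemma rescaled_posterior_ball:
  assumes x: "x \<in> H"
  shows "measure (rescaled_posterior n x) {y \<in> H. nrm y \<le> t}
    = measure (posterior_H B \<delta> prior n x) {f \<in> H. sqrt (real n) * dst f x \<le> t}"
proof -
  have sp: "space (posterior_H B \<delta> prior n x) = H"
    using sets_eq_imp_space_eq[OF sets_posterior_H] by simp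
  have "measure (rescaled_posterior n x) {y \<in> H. nrm y \<le> t}
      = measure (posterior_H B \<delta> prior n x) (rescale n x -` {y \<in> H. nrm y \<le> t} \<inter> H)"
    using measure_distr[OF rescale_posterior_measurable[OF x] nrm_le_sets[OF refl]] by (simp add: sp)
  also have "rescale n x -` {y \<in> H. nrm y \<le> t} \<inter> H = {f \<in> H. sqrt (real n) * dst f x \<le> t}"
    using rescale_in_H[OF x] by (auto simp: nrm_rescale)
  finally show ?thesis .
qed

lemma sets_noise_law: "sets (noise_law B \<delta> M W) = sets bor"
  by (simp add: noise_law_def)

lemma noise_law_mass: "emeasure (noise_law B \<delta> M W) H \<le> 1"
proof -
  interpret N: prob_space "noise_law B \<delta> M W"
    unfolding noise_law_def by (rule prob_space_distr) (rule W_measurable)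
  show ?thesis
    by (rule N.emeasure_le_1)
qed

lemma noise_law_ball: "measure (noise_law B \<delta> M W) {x \<in> H. nrm x \<le> t} = nrm_cdf t"
proof -
  have "measure (noise_law B \<delta> M W) {x \<in> H. nrm x \<le> t}
      = prob (W -` {x \<in> H. nrm x \<le> t} \<inter> space M)"
    unfolding noise_law_def by (intro measure_distr W_measurable nrm_le_sets refl)
  also have "W -` {x \<in> H. nrm x \<le> t} \<inter> space M = {\<omega> \<in> space M. nrm (W \<omega>) \<le> t}"
    using W_in_H by auto
  finally show ?thesis
    by (simp add: nrm_cdf_def)
qed

lemma data_law_measurable: "(\<lambda>\<omega> i. l2_coeffs B f i + W \<omega> i / r) \<in> M \<rightarrow>\<^sub>M bor"
  by (rule measurable_compose[OF W_measurable affine_measurable[OF l2_coeffs_in_H]])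

lemma data_law_prob_space: "prob_space (data_law B \<delta> M W f n)"
  unfolding data_law_def by (rule prob_space_distr) (rule data_law_measurable)

lemma sets_data_law: "sets (data_law B \<delta> M W f n) = sets bor"
  by (simp add: data_law_def)

lemma space_data_law: "space (data_law B \<delta> M W f n) = H"
  by (simp add: data_law_def)

lemma truth_ball_sets:
  "{x \<in> H. sqrt (real n) * dst (l2_coeffs B f) x \<le> t} \<in> sets bor"
proof -
  have "(\<lambda>x. dst x (l2_coeffs B f)) \<in> borel_measurable bor"
    by (rule dst_measurable[OF l2_coeffs_in_H])
  then have "{x \<in> space bor. sqrt (real n) * dst x (l2_coeffs B f) \<le> t} \<in> sets bor"
    by measurable
  then show ?thesis
    by (simp add: commute)
qed

text \<open>The difference between truth and data is exactly the noise, up to sign, divided by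
  \<open>sqrt (real n)\<close>. Rescaling therefore returns the noise norm for every n \<ge> 1, not
  merely in the limit.\<close>

lemma data_law_truth_ball:
  assumes n: "n \<ge> 1"
  shows "measure (data_law B \<delta> M W f n) {x \<in> H. sqrt (real n) * dst (l2_coeffs B f) x \<le> t} = nrm_cdf t"
proof -
  let ?g = "\<lambda>\<omega> i. l2_coeffs B f i + W \<omega> i / sqrt (real n)"
  have "dst (l2_coeffs B f) (?g \<omega>) = \<bar>- (1 / sqrt (real n))\<bar> * nrm (W \<omega>)" for \<omega>
    unfolding nrm_scale[symmetric] by (simp add: hdist_def)
  then have d: "sqrt (real n) * dst (l2_coeffs B f) (?g \<omega>) = nrm (W \<omega>)" for \<omega>
    using n by simp
  have "measure (data_law B \<delta> M W f n) {x \<in> H. sqrt (real n) * dst (l2_coeffs B f) x \<le> t}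
      = prob (?g -` {x \<in> H. sqrt (real n) * dst (l2_coeffs B f) x \<le> t} \<inter> space M)"
    unfolding data_law_def by (intro measure_distr data_law_measurable truth_ball_sets)
  also have "?g -` {x \<in> H. sqrt (real n) * dst (l2_coeffs B f) x \<le> t} \<inter> space M
      = {\<omega> \<in> space M. nrm (W \<omega>) \<le> t}"
    using measurable_space[OF data_law_measurable[of f "sqrt (real n)"]] by (auto simp: d)
  finally show ?thesis
    by (simp add: nrm_cdf_def)
qed

text \<open>In units of \<open>1 / sqrt (real n)\<close> the ball of radius r about z contains the
  ball of radius r - e about x and lies in that of radius r + e. Passing between posterior and noise
  costs a further e in the radius and \<eta> in mass, whence the shifts by 2 * e.\<close>

lemma credible_radius_quantile:
  assumes n: "n \<ge> 1" and x: "x \<in> H" and z: "z \<in> H" and e: "0 < e"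
    and bl: "(1 + 1 / e) * bl_metric B \<delta> (rescaled_posterior n x) (noise_law B \<delta> M W) \<le> \<eta>"
    and zx: "sqrt (real n) * dst z x \<le> e"
    and r: "measure (posterior_H B \<delta> prior n x) (credible_set B \<delta> n z r) = p"
  shows "nrm_cdf (r - 2 * e) \<le> p + \<eta>" and "p - \<eta> \<le> nrm_cdf (r + 2 * e)"
proof -
  let ?P = "posterior_H B \<delta> prior n x"
  let ?\<mu> = "rescaled_posterior n x" and ?\<nu> = "noise_law B \<delta> M W"
  let ?near = "\<lambda>t. {f \<in> H. sqrt (real n) * dst f x \<le> t}"
  have sp: "space ?P = H"
    using sets_eq_imp_space_eq[OF sets_posterior_H] by simp
  interpret P: finite_measure ?P
    using posterior_H_mass[OF x, of n] by (intro finite_measureI) (auto simp: sp top_unique)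
  have n0: "0 < sqrt (real n)"
    using n by simp
  have cred: "credible_set B \<delta> n z r = {f \<in> H. sqrt (real n) * dst f z \<le> r}"
    using n0 by (auto simp: credible_set_def field_simps)
  have near_sets: "?near t \<in> sets ?P" for t
  proof -
    have "{f \<in> space bor. sqrt (real n) * dst f x \<le> t} \<in> sets bor"
      using dst_measurable[OF x] by measurable
    then show ?thesis
      by (simp add: sets_posterior_H)
  qed
  have cred_sets: "credible_set B \<delta> n z r \<in> sets ?P"
  proof -
    have "{f \<in> space bor. sqrt (real n) * dst f z \<le> r} \<in> sets bor"
      using dst_measurable[OF z] by measurable
    then show ?thesis
      by (simp add: sets_posterior_H cred)
  qed
  have tri: "sqrt (real n) * dst f x \<le> sqrt (real n) * dst f z + e"
    "sqrt (real n) * dst f z \<le> sqrt (real n) * dst f x + e" if f: "f \<in> H" for f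
  proof -
    have "sqrt (real n) * dst f x \<le> sqrt (real n) * (dst f z + dst z x)"
      "sqrt (real n) * dst f z \<le> sqrt (real n) * (dst f x + dst z x)"
      using triangle[OF f z x] triangle[OF f x z] commute[of x z] n0
      by (auto intro!: mult_left_mono)
    then show "sqrt (real n) * dst f x \<le> sqrt (real n) * dst f z + e"
      "sqrt (real n) * dst f z \<le> sqrt (real n) * dst f x + e"
      using zx by (auto simp: distrib_left)
  qed
  note mu = sets_distr rescaled_posterior_mass[OF x]
  note nu = sets_noise_law noise_law_mass
  have "p \<le> measure ?P (?near (r + e))"
    unfolding r[symmetric] using tri(1)
    by (intro P.finite_measure_mono near_sets) (force simp: cred)
  also have "\<dots> = measure ?\<mu> {y \<in> H. nrm y \<le> r + e}"
    by (rule rescaled_posterior_ball[OF x, symmetric])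
  also have "\<dots> \<le> measure ?\<nu> {y \<in> H. nrm y \<le> r + 2 * e} + \<eta>"
    using ball_mass_le[OF mu nu e, of n "r + e"] bl by (simp add: add.commute[of "2 * e"])
  finally show "p - \<eta> \<le> nrm_cdf (r + 2 * e)"
    unfolding noise_law_ball by simp
  have "nrm_cdf (r - 2 * e) = measure ?\<nu> {y \<in> H. nrm y \<le> r - 2 * e}"
    by (rule noise_law_ball[symmetric])
  also have "\<dots> \<le> measure ?\<mu> {y \<in> H. nrm y \<le> r - 2 * e + e} + \<eta>"
    using ball_mass_le[OF nu mu e, of "r - 2 * e" n] bl
    by (simp add: bl_metric_commute[of "noise_law B \<delta> M W"])
  also have "measure ?\<mu> {y \<in> H. nrm y \<le> r - 2 * e + e} = measure ?P (?near (r - 2 * e + e))"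
    by (rule rescaled_posterior_ball[OF x])
  also have "\<dots> \<le> p"
    unfolding r[symmetric] using tri(2)
    by (intro P.finite_measure_mono cred_sets) (force simp: cred)
  finally show "nrm_cdf (r - 2 * e) \<le> p + \<eta>"
    by simp
qed

text \<open>The exceptional set is the union of a measurable cover of the event that the bounded
  Lipschitz distance is large, a cover of the event that the centre is far from the data, and a null
  set outside which the centre lies in H and the credible ball has its exact mass. Off it
  \<open>credible_radius_quantile\<close> applies.\<close>

lemma good_event:
  assumes bvm: "weak_BvM B \<delta> M W prior f0"
    and R: "credible_radius B \<delta> M W prior f0 \<alpha> z R" and \<alpha>: "\<alpha> < 1"
    and zH: "\<forall>n\<ge>1. AE x in data_law B \<delta> M W f0 n. z n x \<in> H"
    and zx: "tendsto_zero_in_prob (data_law B \<delta> M W f0) (\<lambda>n x. sqrt (real n) * dst (z n x) x)"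
    and e: "0 < e" and \<eta>: "0 < \<eta>"
  shows "\<forall>\<^sub>F n in sequentially. \<exists>E\<in>sets bor. measure (data_law B \<delta> M W f0 n) E < \<eta> \<and>
    (\<forall>x\<in>H - E. z n x \<in> H \<and> 0 \<le> R n x \<and> sqrt (real n) * dst (z n x) x \<le> e \<and>
      nrm_cdf (R n x - 2 * e) \<le> 1 - \<alpha> + \<eta> \<and> 1 - \<alpha> - \<eta> \<le> nrm_cdf (R n x + 2 * e))"
proof -
  let ?P = "data_law B \<delta> M W f0"
  let ?bl = "\<lambda>n x. bl_metric B \<delta> (rescaled_posterior n x) (noise_law B \<delta> M W)"
  \<comment> \<open>Chosen so that the factor from \<open>ball_mass_le\<close> turns it into
    \<eta>.\<close>
  define \<kappa> where "\<kappa> = \<eta> / (1 + 1 / e)"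
  have "0 < 1 + 1 / e"
    using e by (simp add: add_pos_pos)
  then have \<kappa>: "0 < \<kappa>" "(1 + 1 / e) * \<kappa> = \<eta>"
    using \<eta> by (simp_all add: \<kappa>_def)
  have "\<forall>\<^sub>F n in sequentially. outer_prob (?P n) {x \<in> space (?P n). \<bar>?bl n x\<bar> > \<kappa>} < \<eta> / 2"
    using bvm \<kappa>(1) \<eta> unfolding weak_BvM_def tendsto_zero_in_prob_def
    by (intro order_tendstoD(2)[where y = 0]) auto
  moreover have "\<forall>\<^sub>F n in sequentially.
      outer_prob (?P n) {x \<in> space (?P n). \<bar>sqrt (real n) * dst (z n x) x\<bar> > e} < \<eta> / 2"
    using zx e \<eta> unfolding tendsto_zero_in_prob_def
    by (intro order_tendstoD(2)[where y = 0]) auto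
  ultimately show ?thesis
    using eventually_ge_at_top[of 1]
  proof eventually_elim
    case (elim n)
    interpret P: prob_space "?P n" by (rule data_law_prob_space)
    obtain E1 where E1: "E1 \<in> sets bor" "{x \<in> H. \<bar>?bl n x\<bar> > \<kappa>} \<subseteq> E1" "measure (?P n) E1 < \<eta> / 2"
      using outer_prob_less_cover[OF elim(1)] by (auto simp: space_data_law sets_data_law)
    obtain E2 where E2: "E2 \<in> sets bor"
        "{x \<in> H. \<bar>sqrt (real n) * dst (z n x) x\<bar> > e} \<subseteq> E2" "measure (?P n) E2 < \<eta> / 2"
      using outer_prob_less_cover[OF elim(2)] by (auto simp: space_data_law sets_data_law)
    have ae: "AE x in ?P n. z n x \<in> H \<and>
        measure (posterior_H B \<delta> prior n x) (credible_set B \<delta> n (z n x) (R n x)) = 1 - \<alpha>"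
      using R zH elim(3) unfolding credible_radius_def by auto
    obtain E3 where
      E3_good: "\<And>x. x \<in> space (?P n) - E3 \<Longrightarrow> z n x \<in> H \<and>
        measure (posterior_H B \<delta> prior n x) (credible_set B \<delta> n (z n x) (R n x)) = 1 - \<alpha>"
      and null: "E3 \<in> null_sets (?P n)"
      by (rule AE_E3[OF ae]) (rule that)
    have E3: "E3 \<in> sets bor" "measure (?P n) E3 = 0"
      using null by (auto simp: null_sets_def sets_data_law measure_def)
    let ?E = "E1 \<union> (E2 \<union> E3)"
    have "measure (?P n) ?E \<le> measure (?P n) E1 + (measure (?P n) E2 + measure (?P n) E3)"
      using E1(1) E2(1) E3(1)
      by (intro order_trans[OF measure_Un_le] add_left_mono)
         (auto simp: sets_data_law)
    then have "measure (?P n) ?E < \<eta>"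
      using E1(3) E2(3) E3(2) by linarith
    moreover have "z n x \<in> H \<and> 0 \<le> R n x \<and> sqrt (real n) * dst (z n x) x \<le> e \<and>
        nrm_cdf (R n x - 2 * e) \<le> 1 - \<alpha> + \<eta> \<and> 1 - \<alpha> - \<eta> \<le> nrm_cdf (R n x + 2 * e)"
      if x: "x \<in> H - ?E" for x
    proof -
      have xH: "x \<in> H" and "x \<notin> E1" "x \<notin> E2" "x \<notin> E3"
        using x by auto
      then have zxH: "z n x \<in> H"
        and r: "measure (posterior_H B \<delta> prior n x) (credible_set B \<delta> n (z n x) (R n x)) = 1 - \<alpha>"
        using E3_good[of x] by (simp_all add: space_data_law)
      have "\<not> \<bar>?bl n x\<bar> > \<kappa>" "\<not> \<bar>sqrt (real n) * dst (z n x) x\<bar> > e"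
        using xH \<open>x \<notin> E1\<close> \<open>x \<notin> E2\<close> E1(2) E2(2) by blast+
      then have b: "?bl n x \<le> \<kappa>" and d: "sqrt (real n) * dst (z n x) x \<le> e"
        by linarith+
      have "(1 + 1 / e) * ?bl n x \<le> \<eta>"
        unfolding \<kappa>(2)[symmetric] using b e by (intro mult_left_mono) auto
      note q = credible_radius_quantile[OF elim(3) xH zxH e this d r]
      \<comment> \<open>A negative radius gives the empty set, of mass 0, whereas 1 - \<alpha> is
        positive.\<close>
      have "0 \<le> R n x"
      proof (rule ccontr)
        assume "\<not> 0 \<le> R n x"
        then have "R n x / sqrt (real n) < 0"
          using elim(3) by (simp add: divide_neg_pos)
        then have "\<not> dst f (z n x) \<le> R n x / sqrt (real n)" for f
          using nonneg[of f "z n x"] by linarith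
        then have "credible_set B \<delta> n (z n x) (R n x) = {}"
          by (simp add: credible_set_def)
        with r \<alpha> show False by simp
      qed
      with zxH d q show ?thesis by blast
    qed
    ultimately show ?case
      using E1(1) E2(1) E3(1) by (intro bexI[of _ ?E]) auto
  qed
qed

text \<open>Quantiles a and b at levels just below and above 1 - \<alpha> trap the random radius off
  a small set. Coverage is then compared with the event that the data fall within a fixed rescaled
  radius of the truth, whose probability is known exactly. The centre z is kept general so that both
  centrings are instances.\<close>

lemma credible_ball_coverage:
  assumes bvm: "weak_BvM B \<delta> M W prior f0"
    and R: "credible_radius B \<delta> M W prior f0 \<alpha> z R" and \<alpha>: "0 < \<alpha>" "\<alpha> < 1"
    and zH: "\<forall>n\<ge>1. AE x in data_law B \<delta> M W f0 n. z n x \<in> H"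
    and zx: "tendsto_zero_in_prob (data_law B \<delta> M W f0) (\<lambda>n x. sqrt (real n) * dst (z n x) x)"
    and meas: "\<And>n. n \<ge> 1 \<Longrightarrow> {x \<in> H. l2_coeffs B f0 \<in> credible_set B \<delta> n (z n x) (R n x)} \<in> sets bor"
  shows "(\<lambda>n. measure (data_law B \<delta> M W f0 n)
           {x \<in> space (data_law B \<delta> M W f0 n). l2_coeffs B f0 \<in> credible_set B \<delta> n (z n x) (R n x)})
         \<longlonglongrightarrow> 1 - \<alpha>"
    and "bounded_in_prob (data_law B \<delta> M W f0) R"
proof -
  let ?P = "data_law B \<delta> M W f0" and ?c = "l2_coeffs B f0"
  let ?cov = "\<lambda>n. {x \<in> H. ?c \<in> credible_set B \<delta> n (z n x) (R n x)}"
  \<comment> \<open>Both conclusions are read off the same exceptional event, so they are proved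
    together for one \<epsilon>.\<close>
  define bound where "bound \<epsilon> K n \<longleftrightarrow> \<bar>measure (?P n) (?cov n) - (1 - \<alpha>)\<bar> < \<epsilon> \<and>
      outer_prob (?P n) {x \<in> space (?P n). \<bar>R n x\<bar> > K} < \<epsilon>" for \<epsilon> K n
  have key: "\<exists>K. \<forall>\<^sub>F n in sequentially. bound \<epsilon> K n" if \<epsilon>: "\<epsilon> > 0" for \<epsilon> :: real
  proof -
    \<comment> \<open>The fifth of \<epsilon> absorbs a total error of 4 * \<eta>; the thirds keep
      the levels 1 - \<alpha> - 2 * \<eta> and 1 - \<alpha> + 2 * \<eta> strictly between 0 and
      1.\<close>
    define \<eta> where "\<eta> = min (\<epsilon> / 5) (min (\<alpha> / 3) ((1 - \<alpha>) / 3))"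
    have \<eta>: "0 < \<eta>" "5 * \<eta> \<le> \<epsilon>" "2 * \<eta> < \<alpha>" "2 * \<eta> < 1 - \<alpha>"
      using \<epsilon> \<alpha> by (auto simp: \<eta>_def min_def)
    have "0 < 1 - \<alpha> - 2 * \<eta>" "1 - \<alpha> - 2 * \<eta> < 1" "0 < 1 - \<alpha> + 2 * \<eta>" "1 - \<alpha> + 2 * \<eta> < 1"
      using \<eta> \<alpha> by linarith+
    then obtain a b where ab: "nrm_cdf a = 1 - \<alpha> - 2 * \<eta>" "nrm_cdf b = 1 - \<alpha> + 2 * \<eta>"
      using nrm_cdf_quantile[of "1 - \<alpha> - 2 * \<eta>"] nrm_cdf_quantile[of "1 - \<alpha> + 2 * \<eta>"] by blast
    have cont: "\<exists>d>0. \<forall>t. \<bar>t - s\<bar> < d \<longrightarrow> \<bar>nrm_cdf t - nrm_cdf s\<bar> < \<eta>" for s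
      using nrm_cdf_isCont[of s] \<eta>(1) by (simp add: continuous_at_eps_delta dist_real_def)
    obtain d1 where d1: "d1 > 0" "\<And>t. \<bar>t - a\<bar> < d1 \<Longrightarrow> \<bar>nrm_cdf t - nrm_cdf a\<bar> < \<eta>"
      using cont[of a] by blast
    obtain d2 where d2: "d2 > 0" "\<And>t. \<bar>t - b\<bar> < d2 \<Longrightarrow> \<bar>nrm_cdf t - nrm_cdf b\<bar> < \<eta>"
      using cont[of b] by blast
    \<comment> \<open>The total shift is 3 * e: 2 * e from trapping the radius and e from the
      displaced centre. The quarter keeps it inside both continuity radii.\<close>
    define e where "e = min d1 d2 / 4"
    have e: "0 < e" "3 * e < d1" "3 * e < d2"
      using d1(1) d2(1) by (auto simp: e_def min_def)
    have cdf: "nrm_cdf (a - 3 * e) > 1 - \<alpha> - 3 * \<eta>" "nrm_cdf (b + 3 * e) < 1 - \<alpha> + 3 * \<eta>"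
    proof -
      have "\<bar>nrm_cdf (a - 3 * e) - nrm_cdf a\<bar> < \<eta>" "\<bar>nrm_cdf (b + 3 * e) - nrm_cdf b\<bar> < \<eta>"
        using e by (intro d1(2) d2(2); simp)+
      then show "nrm_cdf (a - 3 * e) > 1 - \<alpha> - 3 * \<eta>" "nrm_cdf (b + 3 * e) < 1 - \<alpha> + 3 * \<eta>"
        using ab by linarith+
    qed
    have "\<forall>\<^sub>F n in sequentially. bound \<epsilon> (b + 2 * e) n"
      using good_event[OF bvm R \<alpha>(2) zH zx e(1) \<eta>(1)] eventually_ge_at_top[of 1]
    proof eventually_elim
      case (elim n)
      interpret P: prob_space "?P n" by (rule data_law_prob_space)
      have n0: "0 < sqrt (real n)"
        using elim(2) by simp
      obtain E where E: "E \<in> sets bor" "measure (?P n) E < \<eta>"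
        and "\<forall>x\<in>H - E. z n x \<in> H \<and> 0 \<le> R n x \<and> sqrt (real n) * dst (z n x) x \<le> e \<and>
          nrm_cdf (R n x - 2 * e) \<le> 1 - \<alpha> + \<eta> \<and> 1 - \<alpha> - \<eta> \<le> nrm_cdf (R n x + 2 * e)"
        using elim(1) by blast
      then have good: "z n x \<in> H" "0 \<le> R n x" "sqrt (real n) * dst (z n x) x \<le> e"
          "nrm_cdf (R n x - 2 * e) \<le> 1 - \<alpha> + \<eta>" "1 - \<alpha> - \<eta> \<le> nrm_cdf (R n x + 2 * e)"
        if "x \<in> H" "x \<notin> E" for x
        using that by auto
      \<comment> \<open>If \<open>R n x - 2 * e\<close> reached b, monotonicity would give at least
        level 1 - \<alpha> + 2 * \<eta>, against the bound 1 - \<alpha> + \<eta>; dually for a. The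
        gap \<eta> between the levels replaces strict monotonicity.\<close>
      have Rb: "R n x < b + 2 * e" and Ra: "a - 2 * e < R n x" if x: "x \<in> H" "x \<notin> E" for x
        using good(4,5)[OF x] ab \<eta>(1) nrm_cdf_mono[of b "R n x - 2 * e"] nrm_cdf_mono[of "R n x + 2 * e" a]
        by linarith+
      have tri: "sqrt (real n) * dst ?c x \<le> sqrt (real n) * dst ?c (z n x) + e"
        "sqrt (real n) * dst ?c (z n x) \<le> sqrt (real n) * dst ?c x + e" if x: "x \<in> H" "x \<notin> E" for x
      proof -
        note cH = l2_coeffs_in_H[of f0]
        have "sqrt (real n) * dst ?c x \<le> sqrt (real n) * (dst ?c (z n x) + dst (z n x) x)"
          "sqrt (real n) * dst ?c (z n x) \<le> sqrt (real n) * (dst ?c x + dst (z n x) x)"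
          using triangle[OF cH good(1)[OF x] x(1)] triangle[OF cH x(1) good(1)[OF x]]
            commute[of x "z n x"] n0
          by (auto intro!: mult_left_mono)
        then show "sqrt (real n) * dst ?c x \<le> sqrt (real n) * dst ?c (z n x) + e"
          "sqrt (real n) * dst ?c (z n x) \<le> sqrt (real n) * dst ?c x + e"
          using good(3)[OF x] by (auto simp: distrib_left)
      qed
      have cov: "?cov n = {x \<in> H. sqrt (real n) * dst ?c (z n x) \<le> R n x}"
        using n0 l2_coeffs_in_H by (auto simp: credible_set_def field_simps)
      let ?ball = "\<lambda>t. {x \<in> H. sqrt (real n) * dst ?c x \<le> t}"
      have sets: "?cov n \<in> P.events" "?ball t \<in> P.events" "E \<in> P.events" for t
        using meas[OF elim(2)] truth_ball_sets E(1) by (auto simp: sets_data_law)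
      \<comment> \<open>Off E the trap and the triangle inequality place the coverage event between
        two balls of fixed rescaled radii about the truth; E itself adds less than \<eta>.\<close>
      have "?cov n \<subseteq> ?ball (b + 3 * e) \<union> E"
      proof
        fix x assume x: "x \<in> ?cov n"
        show "x \<in> ?ball (b + 3 * e) \<union> E"
        proof (cases "x \<in> E")
          case False
          with x tri(1)[of x] Rb[of x] show ?thesis
            unfolding cov by simp
        qed simp
      qed
      then have "measure (?P n) (?cov n) \<le> measure (?P n) (?ball (b + 3 * e) \<union> E)"
        using sets by (intro P.finite_measure_mono) auto
      also have "\<dots> \<le> nrm_cdf (b + 3 * e) + measure (?P n) E"
        using measure_Un_le[OF sets(2,3)] data_law_truth_ball[OF elim(2)] by simp
      finally have upper: "measure (?P n) (?cov n) < 1 - \<alpha> + 4 * \<eta>"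
        using cdf(2) E(2) by linarith
      have "?ball (a - 3 * e) \<subseteq> ?cov n \<union> E"
      proof
        fix x assume x: "x \<in> ?ball (a - 3 * e)"
        show "x \<in> ?cov n \<union> E"
        proof (cases "x \<in> E")
          case False
          with x tri(2)[of x] Ra[of x] show ?thesis
            unfolding cov by simp
        qed simp
      qed
      then have "measure (?P n) (?ball (a - 3 * e)) \<le> measure (?P n) (?cov n \<union> E)"
        using sets by (intro P.finite_measure_mono) auto
      also have "\<dots> \<le> measure (?P n) (?cov n) + measure (?P n) E"
        by (rule measure_Un_le[OF sets(1,3)])
      finally have lower: "1 - \<alpha> - 4 * \<eta> < measure (?P n) (?cov n)"
        using cdf(1) E(2) data_law_truth_ball[OF elim(2), of f0 "a - 3 * e"] by linarith
      \<comment> \<open>Off E the radius is nonnegative, so the upper trap alone bounds its absolute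
        value.\<close>
      have "{x \<in> space (?P n). \<bar>R n x\<bar> > b + 2 * e} \<subseteq> E"
      proof
        fix x assume x: "x \<in> {x \<in> space (?P n). \<bar>R n x\<bar> > b + 2 * e}"
        then have xH: "x \<in> H"
          by (simp add: space_data_law)
        show "x \<in> E"
          using x good(2)[OF xH] Rb[OF xH] by fastforce
      qed
      from outer_prob_le[OF sets(3) this]
      have "outer_prob (?P n) {x \<in> space (?P n). \<bar>R n x\<bar> > b + 2 * e} < \<epsilon>"
        using E(2) \<eta> by linarith
      then show "bound \<epsilon> (b + 2 * e) n"
        using upper lower \<eta> unfolding bound_def by linarith
    qed
    then show ?thesis by blast
  qed
  show "bounded_in_prob ?P R"
    unfolding bounded_in_prob_def
  proof (intro allI impI)
    fix \<epsilon> :: real assume "0 < \<epsilon>"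
    then obtain K where "\<forall>\<^sub>F n in sequentially. bound \<epsilon> K n"
      using key by blast
    then have "\<forall>\<^sub>F n in sequentially. outer_prob (?P n) {x \<in> space (?P n). \<bar>R n x\<bar> > K} < \<epsilon>"
      by (rule eventually_mono) (simp add: bound_def)
    then show "\<exists>K. \<forall>\<^sub>F n in sequentially. outer_prob (?P n) {x \<in> space (?P n). \<bar>R n x\<bar> > K} < \<epsilon>"
      by (rule exI)
  qed
  show "(\<lambda>n. measure (?P n) {x \<in> space (?P n). ?c \<in> credible_set B \<delta> n (z n x) (R n x)}) \<longlonglongrightarrow> 1 - \<alpha>"
    unfolding space_data_law
  proof (rule tendstoI)
    fix \<epsilon> :: real assume "0 < \<epsilon>"
    then obtain K where "\<forall>\<^sub>F n in sequentially. bound \<epsilon> K n"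
      using key by blast
    then show "\<forall>\<^sub>F n in sequentially. dist (measure (?P n) (?cov n)) (1 - \<alpha>) < \<epsilon>"
      by (rule eventually_mono) (simp add: bound_def dist_real_def)
  qed
qed

text \<open>The distance to the centre is measurable as a norm given coordinatewise. Coordinates are
  what is known of the posterior mean, which may leave H on a null set.\<close>

lemma coverage_event_sets:
  assumes z: "\<And>i. i \<in> idx B \<Longrightarrow> (\<lambda>x. z x i) \<in> borel_measurable bor"
    and r: "r \<in> borel_measurable bor"
  shows "{x \<in> H. l2_coeffs B f \<in> credible_set B \<delta> n (z x) (r x)} \<in> sets bor"
proof -
  have "(\<lambda>x. dst (l2_coeffs B f) (z x)) \<in> borel_measurable bor"
    unfolding hdist_def using z
    by (intro nrm_coordinatewise_measurable borel_measurable_diff) auto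
  then have "{x \<in> space bor. dst (l2_coeffs B f) (z x) \<le> r x / sqrt (real n)} \<in> sets bor"
    using r by measurable
  then show ?thesis
    by (simp add: credible_set_def l2_coeffs_in_H)
qed

end

section \<open>Centring at the data and at the posterior mean\<close>

theorem theorem1:
  fixes B :: wbasis and S :: nat and \<delta> \<alpha> :: real
    and M :: "'w measure" and W :: "'w \<Rightarrow> int \<times> int \<Rightarrow> real"
    and prior :: "l2 measure" and f0 :: l2
  assumes "S \<ge> 1" and "regular_basis S B" and "\<delta> > 1 / 2"
    and "white_noise B \<delta> M W"
    and "prob_space prior" and "sets prior = sets borel"
    and "weak_BvM B \<delta> M W prior f0"
    and "0 < \<alpha>" and "\<alpha> < 1"
  shows "(\<forall>R. credible_radius B \<delta> M W prior f0 \<alpha> (\<lambda>n x. x) R \<longrightarrow>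
            (\<lambda>n. measure (data_law B \<delta> M W f0 n)
               {x \<in> space (data_law B \<delta> M W f0 n). l2_coeffs B f0 \<in> credible_set B \<delta> n x (R n x)})
              \<longlonglongrightarrow> 1 - \<alpha> \<and>
            bounded_in_prob (data_law B \<delta> M W f0) R) \<and>
         ((\<forall>n\<ge>1. AE x in data_law B \<delta> M W f0 n. has_posterior_mean B \<delta> prior n x) \<longrightarrow>
          tendsto_zero_in_prob (data_law B \<delta> M W f0)
            (\<lambda>n x. sqrt (real n) * hdist B \<delta> (posterior_mean B prior n x) x) \<longrightarrow>
          (\<forall>R. credible_radius B \<delta> M W prior f0 \<alpha> (posterior_mean B prior) R \<longrightarrow>
            (\<lambda>n. measure (data_law B \<delta> M W f0 n)
               {x \<in> space (data_law B \<delta> M W f0 n).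
                  l2_coeffs B f0 \<in> credible_set B \<delta> n (posterior_mean B prior n x) (R n x)})
              \<longlonglongrightarrow> 1 - \<alpha> \<and>
            bounded_in_prob (data_law B \<delta> M W f0) R))"
proof -
  have "characteristic_seq B" "orthonormal_basis B" "\<delta> > 0"
    using assms(2,3) by (simp_all add: regular_basis_def)
  then interpret prior_model B \<delta> M W prior
    using assms(4-6)
    by (intro prior_model.intro prior_model_axioms.intro noise_model.intro noise_model_axioms.intro
        basis_space.intro basis_space_axioms.intro sequence_space.intro)
  have R_meas: "R n \<in> borel_measurable bor"
    if "credible_radius B \<delta> M W prior f0 \<alpha> z R" "n \<ge> 1" for z R n
    using that by (simp add: credible_radius_def)
  \<comment> \<open>With the data as centre the displacement is identically zero, so every event in
    question is empty.\<close>
  have H0: "tendsto_zero_in_prob (data_law B \<delta> M W f0) (\<lambda>n x. sqrt (real n) * dst x x)"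
  proof -
    have "outer_prob P {} = 0" for P :: "(int \<times> int \<Rightarrow> real) measure"
      using outer_prob_le[of "{}" P "{}"] outer_prob_nonneg[of "{}" P] by simp
    then show ?thesis
      by (simp add: tendsto_zero_in_prob_def hdist_def)
  qed
  have HX: "\<forall>n\<ge>1. AE x in data_law B \<delta> M W f0 n. x \<in> H"
    by (intro allI impI AE_I2) (simp add: space_data_law)
  show ?thesis
  proof (intro conjI allI impI)
    fix R assume R: "credible_radius B \<delta> M W prior f0 \<alpha> (\<lambda>n x. x) R"
    have "{x \<in> H. l2_coeffs B f0 \<in> credible_set B \<delta> n x (R n x)} \<in> sets bor" if "n \<ge> 1" for n
      using that by (intro coverage_event_sets coordinate_measurable R_meas[OF R])
    note * = credible_ball_coverage[where z = "\<lambda>n x. x", OF assms(7) R assms(8,9) HX H0 this]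
    show "(\<lambda>n. measure (data_law B \<delta> M W f0 n)
        {x \<in> space (data_law B \<delta> M W f0 n). l2_coeffs B f0 \<in> credible_set B \<delta> n x (R n x)})
        \<longlonglongrightarrow> 1 - \<alpha>" "bounded_in_prob (data_law B \<delta> M W f0) R"
      by (rule *; assumption)+
  next
    fix R
    assume mean: "\<forall>n\<ge>1. AE x in data_law B \<delta> M W f0 n. has_posterior_mean B \<delta> prior n x"
      and zx: "tendsto_zero_in_prob (data_law B \<delta> M W f0)
        (\<lambda>n x. sqrt (real n) * dst (posterior_mean B prior n x) x)"
      and R: "credible_radius B \<delta> M W prior f0 \<alpha> (posterior_mean B prior) R"
    have zH: "\<forall>n\<ge>1. AE x in data_law B \<delta> M W f0 n. posterior_mean B prior n x \<in> H"
      using mean by (auto simp: has_posterior_mean_def)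
    have "{x \<in> H. l2_coeffs B f0 \<in> credible_set B \<delta> n (posterior_mean B prior n x) (R n x)} \<in> sets bor"
      if "n \<ge> 1" for n
      using that by (intro coverage_event_sets posterior_mean_measurable R_meas[OF R])
    note * = credible_ball_coverage[OF assms(7) R assms(8,9) zH zx this]
    show "(\<lambda>n. measure (data_law B \<delta> M W f0 n)
        {x \<in> space (data_law B \<delta> M W f0 n).
          l2_coeffs B f0 \<in> credible_set B \<delta> n (posterior_mean B prior n x) (R n x)})
        \<longlonglongrightarrow> 1 - \<alpha>" "bounded_in_prob (data_law B \<delta> M W f0) R"
      by (rule *; assumption)+
  qed
qed

end
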